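(* For any value of the flux reconstruction parameter $c$ (with $\mathcal M+\mathcal K$ invertible, so that the scheme is defined), the ST-NSFR scheme described in the context is discretely globally conservative. That is, with periodic boundary conditions in space, Dirichlet data $\bm u_0$ at $t=0$, outflow at $t=T$, and reference numerical fluxes that are single-valued on shared interfaces, every solution of the scheme satisfies, for each state of the conservation law, $$\sum_{k=1}^{K_s}\bm 1\,\mathcal W_{f,3}\,\bm f^{*,r}_{t}\Big|_{t=0}=\sum_{k=1}^{K_s}\bm 1\,\mathcal W_{f,4}\,\bm f^{*,r}_{t}\Big|_{t=T},$$ where $\bm f_t^{*,r}|_{t=0}=J_{1D}\bm u_0$ at the face-3 nodes of the elements of the first timeslab, and $\bm f_t^{*,r}|_{t=T}=J_{1D}\tilde{\bm u}_f$ at the face-4 nodes of the elements of the last timeslab. Here the sums run over the $K_s$ elements of the timeslab in question.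
   Context: PDE: $\partial_t \bm u+\partial_x\bm f_s(\bm u)=0$ on $[x_L,x_R]\times[0,T]$, with $N_s$ states, periodic in $x$, $\bm u(x,0)=\bm u_0(x)$, temporal flux $\bm f_t(\bm u)=\bm u$. There is a convex entropy function $s(\bm u)$ with entropy variables $\bm v=\partial s/\partial\bm u$ (the map $\bm u\leftrightarrow\bm v$ being invertible). Mesh: the space-time domain is divided into $K_s\times K_t$ conforming rectangular Cartesian elements ($K_s$ in space, $K_t$ timeslabs in time; a timeslab is the set of elements with the same temporal index). An element of size $\Delta x\times\Delta t$ is mapped to the reference element $[-1,1]^2$ with coordinates $(\xi,\tau)$ ($\xi$ spatial, $\tau$ temporal). $J=\frac14\Delta x\Delta t$, $J_{1D}=\frac12\sqrt{\Delta x\Delta t}$. Faces: 1 is $\xi=-1$, 2 is $\xi=1$, 3 is $\tau=-1$, 4 is $\tau=1$. The unit outward normal has spatial component $\hat n_s=-1,1,0,0$ and temporal component $\hat n_t=0,0,-1,1$ on faces 1,2,3,4. Nodes and bases: vectors are row vectors and $\bm 1$ is a row vector of ones. $\bm\chi$ is the row of $N_{soln}=(p+1)^2$ tensor-product Lagrange polynomials at tensor-product Gauss-Legendre (GL) or Gauss-Lobatto-Legendre (GLL) solution nodes ($p\ge1$). $\bm\phi$ is the row of $N_q=(p+1+N_{OI})^2$ ($N_{OI}\ge0$) tensor-product Lagrange polynomials at GL or GLL flux quadrature nodes $\bar{\bm\xi}_q$. Each face carries $N_f=p+1+N_{OI}$ nodes of the one-dimensional version of the flux quadrature rule; $\bar{\bm\xi}_f$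 collects all $4N_f$ face nodes. $\mathcal W_q,\mathcal W_f,\mathcal W_{f,i}$ are the diagonal matrices of quadrature weights (volume, all faces, face $i$). $\bm\chi(\bar{\bm\xi}_q)$ etc. are matrices with rows indexed by nodes and columns by basis functions. Mass matrix: $\mathcal M=\bm\chi(\bar{\bm\xi}_q)^T\mathcal W_q J\,\bm\chi(\bar{\bm\xi}_q)$. FR matrix: $\mathcal K=\frac{c}{J_{1D}}(\mathcal D_\xi^p)^T\mathcal M\,\mathcal D_\xi^p$, where $\mathcal D_\xi$ is the matrix of $\partial/\partial\xi$ acting on coefficients in the basis $\bm\chi$ and $\mathcal D_\xi^p$ is its $p$-th power. Lifting operators: $L_t=\mathcal M^{-1}\bm\chi(\bar{\bm\xi}_f)^T\mathcal W_f\,\mathrm{diag}(\hat{\bm n}_t)$ and $L_{FR,s}=(\mathcal M+\mathcal K)^{-1}\bm\chi(\bar{\bm\xi}_f)^T\mathcal W_f\,\mathrm{diag}(\hat{\bm n}_s)$. Skew-symmetric stiffness operator: $$(\tilde{\mathcal Q}-\tilde{\mathcal Q}^T)_s=\begin{bmatrix}\mathcal W_q\,\partial_\xi\bm\phi(\bar{\bm\xi}_q)-\partial_\xi\bm\phi(\bar{\bm\xi}_q)^T\mathcal W_q & \bm\phi(\bar{\bm\xi}_f)^T\mathcal W_f\,\mathrm{diag}(\hat{\bm n}_s)\\-\mathcal W_f\,\mathrm{diag}(\hat{\bm n}_s)\bm\phi(\bar{\bm\xi}_f)&\bm 0\end{bmatrix},$$ and $(\tilde{\mathcal Q}-\tilde{\mathcal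 Q}^T)_t$ is the same with $\partial_\tau$ and $\hat{\bm n}_t$. Entropy projection: $\hat{\bm v}^T=\Pi_q\bm v(\bm\chi(\bar{\bm\xi}_q)\hat{\bm u}^T)$ with $\Pi_q=\mathcal M^{-1}\bm\chi(\bar{\bm\xi}_q)^T\mathcal W_qJ$ the discrete $L^2$ projection, and $\tilde{\bm u}(\bar{\bm\xi})=\bm u(\bm\chi(\bar{\bm\xi})\hat{\bm v}^T)$; $\tilde{\bm u}_f$ are the values at face nodes. For symmetric, consistent two-point fluxes $\bm f_s(\cdot,\cdot)$, $\bm f_t(\cdot,\cdot)$, set $(\mathcal F^r_s)_{ij}=J_{1D}\bm f_s(\tilde{\bm u}_i,\tilde{\bm u}_j)$ and $(\mathcal F^r_t)_{ij}=J_{1D}\bm f_t(\tilde{\bm u}_i,\tilde{\bm u}_j)$, where $i,j$ run over all volume flux nodes and face nodes. ST-NSFR scheme: the unknowns are the coefficients $\hat{\bm u}$ on each element. For every element and every state ($\odot$ is the Hadamard product), $$\mathcal M^{-1}[\bm\chi(\bar{\bm\xi}_q)^T\ \bm\chi(\bar{\bm\xi}_f)^T]\left[(\tilde{\mathcal Q}-\tilde{\mathcal Q}^T)_t\odot\mathcal F_t^r\right]\bm 1^T+L_t\bm f_t^{*,r}+(\mathcal M+\mathcal K)^{-1}[\bm\chi(\bar{\bm\xi}_q)^T\ \bm\chi(\bar{\bm\xi}_f)^T]\left[(\tilde{\mathcal Q}-\tilde{\mathcal Q}^T)_s\odot\mathcal F_s^r\right]\bm 1^T+L_{FR,s}\bm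 f_s^{*,r}=\bm 0^T.$$ Here $\bm f_t^{*,r},\bm f_s^{*,r}$ are column vectors of reference numerical flux values at face nodes. They are single-valued: the two elements sharing an interface (including the periodic one) use the same value at each node. *)

theory Defs
  imports "HOL-Analysis.Analysis" "Jordan_Normal_Form.Gauss_Jordan_Elimination"
begin

unbundle no vec_syntax

section \<open>Quadrature rules and Lagrange polynomials on \<open>[-1,1]\<close>\<close>

text \<open>Rodrigues' formula.\<close>
definition legendre :: "nat \<Rightarrow> real poly" where
  "legendre n = Polynomial.smult (1 / (2 ^ n * fact n)) ((pderiv ^^ n) ([:-1, 0, 1:] ^ n))"

datatype rule = GL | GLL

text \<open>The \<open>n\<close> nodes in increasing order; \<^term>\<open>GLL\<close> is meaningful for \<open>n \<ge> 2\<close> only.\<close>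
fun nodes :: "rule \<Rightarrow> nat \<Rightarrow> real list" where
  "nodes GL n = sorted_list_of_set {x. poly (legendre n) x = 0}"
| "nodes GLL n = sorted_list_of_set {x. poly ([:1, 0, -1:] * pderiv (legendre (n - 1))) x = 0}"

definition lagrange :: "real list \<Rightarrow> nat \<Rightarrow> real poly" where
  "lagrange xs i =
     (\<Prod>j \<in> {..<length xs} - {i}. Polynomial.smult (1 / (xs ! i - xs ! j)) [:- (xs ! j), 1:])"

definition weights :: "rule \<Rightarrow> nat \<Rightarrow> real list" where
  "weights r n = map (\<lambda>i. integral {-1..1} (poly (lagrange (nodes r n) i))) [0..<n]"

text \<open>Tensor products: for \<open>n\<close> one-dimensional nodes, index \<open>i < n * n\<close> stands for the pair of
  one-dimensional indices \<open>(i mod n, i div n)\<close>. Points are pairs \<open>(\<xi>, \<tau>)\<close>.\<close>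

definition tensor_pts :: "rule \<Rightarrow> nat \<Rightarrow> (real \<times> real) list" where
  "tensor_pts r n = map (\<lambda>i. (nodes r n ! (i mod n), nodes r n ! (i div n))) [0..<n * n]"

definition tensor_weights :: "rule \<Rightarrow> nat \<Rightarrow> real list" where
  "tensor_weights r n = map (\<lambda>i. weights r n ! (i mod n) * weights r n ! (i div n)) [0..<n * n]"

definition basis :: "rule \<Rightarrow> nat \<Rightarrow> nat \<Rightarrow> real \<times> real \<Rightarrow> real" where
  "basis r n j = (\<lambda>(\<xi>, \<tau>).
     poly (lagrange (nodes r n) (j mod n)) \<xi> * poly (lagrange (nodes r n) (j div n)) \<tau>)"

definition basis_dxi :: "rule \<Rightarrow> nat \<Rightarrow> nat \<Rightarrow> real \<times> real \<Rightarrow> real" where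
  "basis_dxi r n j = (\<lambda>(\<xi>, \<tau>).
     poly (pderiv (lagrange (nodes r n) (j mod n))) \<xi> * poly (lagrange (nodes r n) (j div n)) \<tau>)"

definition basis_dtau :: "rule \<Rightarrow> nat \<Rightarrow> nat \<Rightarrow> real \<times> real \<Rightarrow> real" where
  "basis_dtau r n j = (\<lambda>(\<xi>, \<tau>).
     poly (lagrange (nodes r n) (j mod n)) \<xi> * poly (pderiv (lagrange (nodes r n) (j div n))) \<tau>)"

section \<open>Matrices\<close>

definition eval_mat :: "(nat \<Rightarrow> real \<times> real \<Rightarrow> real) \<Rightarrow> nat \<Rightarrow> (real \<times> real) list \<Rightarrow> real mat" where
  "eval_mat b m pts = mat (length pts) m (\<lambda>(i, j). b j (pts ! i))"

definition diag_of :: "real list \<Rightarrow> real mat" where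
  "diag_of xs = mat_diag (length xs) (\<lambda>i. xs ! i)"

definition hadamard :: "real mat \<Rightarrow> real mat \<Rightarrow> real mat" (infixl \<open>\<odot>\<close> 70) where
  "A \<odot> B = mat (dim_row A) (dim_col A) (\<lambda>(i, j). A $$ (i, j) * B $$ (i, j))"

definition ones :: "nat \<Rightarrow> real vec" where
  "ones n = vec n (\<lambda>_. 1)"

text \<open>Only used for invertible matrices.\<close>
definition mat_inv :: "real mat \<Rightarrow> real mat" where
  "mat_inv A = the (mat_inverse A)"

section \<open>Operators on the reference element\<close>

text \<open>Polynomial degree \<open>p\<close>, overintegration \<open>N\<^sub>O\<^sub>I\<close>, kinds of solution and flux nodes, and the flux
  reconstruction parameter \<open>c\<close>.\<close>
record disc =
  deg :: nat
  overint :: nat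
  soln_rule :: rule
  flux_rule :: rule
  fr_param :: real

definition n_soln :: "disc \<Rightarrow> nat" where
  "n_soln d = (deg d + 1) * (deg d + 1)"

definition n_face :: "disc \<Rightarrow> nat" where
  "n_face d = deg d + 1 + overint d"

definition n_quad :: "disc \<Rightarrow> nat" where
  "n_quad d = n_face d * n_face d"

text \<open>Volume and face nodes together: volume nodes first.\<close>
definition n_all :: "disc \<Rightarrow> nat" where
  "n_all d = n_quad d + 4 * n_face d"

definition vol_pts :: "disc \<Rightarrow> (real \<times> real) list" where
  "vol_pts d = tensor_pts (flux_rule d) (n_face d)"

definition face_nodes :: "disc \<Rightarrow> real list" where
  "face_nodes d = nodes (flux_rule d) (n_face d)"

text \<open>Faces 1, 2, 3, 4 are \<open>\<xi> = -1\<close>, \<open>\<xi> = 1\<close>, \<open>\<tau> = -1\<close>, \<open>\<tau> = 1\<close>, in this order.\<close>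
definition face_pts :: "disc \<Rightarrow> (real \<times> real) list" where
  "face_pts d =
     map (\<lambda>y. (-1, y)) (face_nodes d) @ map (\<lambda>y. (1, y)) (face_nodes d) @
     map (\<lambda>y. (y, -1)) (face_nodes d) @ map (\<lambda>y. (y, 1)) (face_nodes d)"

definition normal_s :: "disc \<Rightarrow> real list" where
  "normal_s d = replicate (n_face d) (-1) @ replicate (n_face d) 1 @
     replicate (n_face d) 0 @ replicate (n_face d) 0"

definition normal_t :: "disc \<Rightarrow> real list" where
  "normal_t d = replicate (n_face d) 0 @ replicate (n_face d) 0 @
     replicate (n_face d) (-1) @ replicate (n_face d) 1"

definition W_q :: "disc \<Rightarrow> real mat" where
  "W_q d = diag_of (tensor_weights (flux_rule d) (n_face d))"

text \<open>The weight matrix of a single face; it is the same for all four faces.\<close>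
definition W_face :: "disc \<Rightarrow> real mat" where
  "W_face d = diag_of (weights (flux_rule d) (n_face d))"

definition W_f :: "disc \<Rightarrow> real mat" where
  "W_f d = (let w = weights (flux_rule d) (n_face d) in diag_of (w @ w @ w @ w))"

definition chi :: "disc \<Rightarrow> (real \<times> real) list \<Rightarrow> real mat" where
  "chi d pts = eval_mat (basis (soln_rule d) (deg d + 1)) (n_soln d) pts"

definition phi :: "disc \<Rightarrow> (real \<times> real) list \<Rightarrow> real mat" where
  "phi d pts = eval_mat (basis (flux_rule d) (n_face d)) (n_quad d) pts"

definition dxi_phi :: "disc \<Rightarrow> (real \<times> real) list \<Rightarrow> real mat" where
  "dxi_phi d pts = eval_mat (basis_dxi (flux_rule d) (n_face d)) (n_quad d) pts"

definition dtau_phi :: "disc \<Rightarrow> (real \<times> real) list \<Rightarrow> real mat" where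
  "dtau_phi d pts = eval_mat (basis_dtau (flux_rule d) (n_face d)) (n_quad d) pts"

text \<open>Coefficients with respect to a Lagrange basis are nodal values, so differentiation acts on
  coefficients by the derivatives of the basis functions at the solution nodes.\<close>
definition D_xi :: "disc \<Rightarrow> real mat" where
  "D_xi d = eval_mat (basis_dxi (soln_rule d) (deg d + 1)) (n_soln d)
     (tensor_pts (soln_rule d) (deg d + 1))"

definition skew_stiffness :: "disc \<Rightarrow> real mat \<Rightarrow> real list \<Rightarrow> real mat" where
  "skew_stiffness d D nrm = four_block_mat
     (W_q d * D - transpose_mat D * W_q d)
     (transpose_mat (phi d (face_pts d)) * W_f d * diag_of nrm)
     (- (W_f d * diag_of nrm * phi d (face_pts d)))
     (0\<^sub>m (4 * n_face d) (4 * n_face d))"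

definition Q_s :: "disc \<Rightarrow> real mat" where
  "Q_s d = skew_stiffness d (dxi_phi d (vol_pts d)) (normal_s d)"

definition Q_t :: "disc \<Rightarrow> real mat" where
  "Q_t d = skew_stiffness d (dtau_phi d (vol_pts d)) (normal_t d)"

section \<open>Operators on an element of size \<open>dx \<times> dt\<close>\<close>

definition jac :: "real \<Rightarrow> real \<Rightarrow> real" where
  "jac dx dt = dx * dt / 4"

definition jac1 :: "real \<Rightarrow> real \<Rightarrow> real" where
  "jac1 dx dt = sqrt (dx * dt) / 2"

definition mass :: "disc \<Rightarrow> real \<Rightarrow> real \<Rightarrow> real mat" where
  "mass d dx dt =
     transpose_mat (chi d (vol_pts d)) * (jac dx dt \<cdot>\<^sub>m W_q d) * chi d (vol_pts d)"

definition fr_mat :: "disc \<Rightarrow> real \<Rightarrow> real \<Rightarrow> real mat" where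
  "fr_mat d dx dt = (fr_param d / jac1 dx dt) \<cdot>\<^sub>m
     (transpose_mat (D_xi d ^\<^sub>m deg d) * mass d dx dt * (D_xi d ^\<^sub>m deg d))"

definition lift_t :: "disc \<Rightarrow> real \<Rightarrow> real \<Rightarrow> real mat" where
  "lift_t d dx dt = mat_inv (mass d dx dt) *
     (transpose_mat (chi d (face_pts d)) * W_f d * diag_of (normal_t d))"

definition lift_fr_s :: "disc \<Rightarrow> real \<Rightarrow> real \<Rightarrow> real mat" where
  "lift_fr_s d dx dt = mat_inv (mass d dx dt + fr_mat d dx dt) *
     (transpose_mat (chi d (face_pts d)) * W_f d * diag_of (normal_s d))"

definition proj_q :: "disc \<Rightarrow> real \<Rightarrow> real \<Rightarrow> real mat" where
  "proj_q d dx dt = mat_inv (mass d dx dt) *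
     (transpose_mat (chi d (vol_pts d)) * (jac dx dt \<cdot>\<^sub>m W_q d))"

section \<open>The conservation law\<close>

text \<open>\<open>states\<close> is the set of admissible states (e.g. positive density and pressure), on which the
  entropy and the fluxes are defined. The components of a state are indexed by the finite type
  \<open>'s\<close>. The numerical two-point fluxes are part of the record.\<close>
record 's law =
  states :: "(real ^ ('s::finite)) set"
  entropy :: "real ^ 's \<Rightarrow> real"
  entropy_var :: "real ^ 's \<Rightarrow> real ^ 's"
  flux_s :: "real ^ 's \<Rightarrow> real ^ 's"
  flux2_s :: "real ^ 's \<Rightarrow> real ^ 's \<Rightarrow> real ^ 's"
  flux2_t :: "real ^ 's \<Rightarrow> real ^ 's \<Rightarrow> real ^ 's"

definition has_convex_entropy :: "('s::finite) law \<Rightarrow> bool" where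
  "has_convex_entropy L \<longleftrightarrow>
     open (states L) \<and> convex_on (states L) (entropy L) \<and>
     (\<forall>w \<in> states L. GDERIV (entropy L) w :> entropy_var L w) \<and>
     inj_on (entropy_var L) (states L)"

definition state_of :: "('s::finite) law \<Rightarrow> real ^ 's \<Rightarrow> real ^ 's" where
  "state_of L = the_inv_into (states L) (entropy_var L)"

definition two_point_flux ::
    "(real ^ 's) set \<Rightarrow> (real ^ 's \<Rightarrow> real ^ 's) \<Rightarrow> (real ^ 's \<Rightarrow> real ^ 's \<Rightarrow> real ^ ('s::finite)) \<Rightarrow> bool"
  where
  "two_point_flux U f F \<longleftrightarrow>
     (\<forall>a \<in> U. \<forall>b \<in> U. F a b = F b a) \<and> (\<forall>a \<in> U. F a a = f a)"

section \<open>The scheme on one element\<close>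

text \<open>Coefficients on an element are given for each state separately.\<close>
type_synonym 's coeffs = "'s \<Rightarrow> real vec"

definition nodal_values :: "real mat \<Rightarrow> 's coeffs \<Rightarrow> nat \<Rightarrow> real ^ ('s::finite)" where
  "nodal_values B c i = vec_lambda (\<lambda>a. (B *\<^sub>v c a) $ i)"

definition entropy_proj ::
    "('s::finite) law \<Rightarrow> disc \<Rightarrow> real \<Rightarrow> real \<Rightarrow> 's coeffs \<Rightarrow> 's coeffs" where
  "entropy_proj L d dx dt u a = proj_q d dx dt *\<^sub>v
     vec (n_quad d) (\<lambda>i. vec_nth (entropy_var L (nodal_values (chi d (vol_pts d)) u i)) a)"

definition chi_all :: "disc \<Rightarrow> real mat" where
  "chi_all d = chi d (vol_pts d) @\<^sub>r chi d (face_pts d)"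

definition utilde ::
    "('s::finite) law \<Rightarrow> disc \<Rightarrow> real \<Rightarrow> real \<Rightarrow> 's coeffs \<Rightarrow> nat \<Rightarrow> real ^ 's" where
  "utilde L d dx dt u i = state_of L (nodal_values (chi_all d) (entropy_proj L d dx dt u) i)"

text \<open>All states at which the scheme evaluates the entropy variables are admissible, and all
  entropy variables that it converts back come from admissible states.\<close>
definition admissible ::
    "('s::finite) law \<Rightarrow> disc \<Rightarrow> real \<Rightarrow> real \<Rightarrow> 's coeffs \<Rightarrow> bool" where
  "admissible L d dx dt u \<longleftrightarrow>
     (\<forall>i < n_quad d. nodal_values (chi d (vol_pts d)) u i \<in> states L) \<and>
     (\<forall>i < n_all d. nodal_values (chi_all d) (entropy_proj L d dx dt u) i
        \<in> entropy_var L ` states L)"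

definition flux_mat ::
    "(real ^ 's \<Rightarrow> real ^ 's \<Rightarrow> real ^ ('s::finite)) \<Rightarrow>
     's law \<Rightarrow> disc \<Rightarrow> real \<Rightarrow> real \<Rightarrow> 's coeffs \<Rightarrow> 's \<Rightarrow> real mat" where
  "flux_mat F L d dx dt u a = mat (n_all d) (n_all d)
     (\<lambda>(i, j). jac1 dx dt * vec_nth (F (utilde L d dx dt u i) (utilde L d dx dt u j)) a)"

text \<open>The left-hand side of the scheme for state \<open>a\<close>, given the reference numerical fluxes
  \<open>ft\<close>, \<open>fs\<close> of that state at all face nodes.\<close>
definition residual ::
    "('s::finite) law \<Rightarrow> disc \<Rightarrow> real \<Rightarrow> real \<Rightarrow> 's coeffs \<Rightarrow> 's \<Rightarrow> real vec \<Rightarrow> real vec \<Rightarrow> real vec"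
  where
  "residual L d dx dt u a ft fs =
     (mat_inv (mass d dx dt) * transpose_mat (chi_all d)) *\<^sub>v
       ((Q_t d \<odot> flux_mat (flux2_t L) L d dx dt u a) *\<^sub>v ones (n_all d))
     + lift_t d dx dt *\<^sub>v ft
     + (mat_inv (mass d dx dt + fr_mat d dx dt) * transpose_mat (chi_all d)) *\<^sub>v
       ((Q_s d \<odot> flux_mat (flux2_s L) L d dx dt u a) *\<^sub>v ones (n_all d))
     + lift_fr_s d dx dt *\<^sub>v fs"

section \<open>The mesh and the global scheme\<close>

text \<open>Element \<open>(k, l)\<close>, \<open>k < nx m\<close>, \<open>l < nt m\<close>, is the rectangle
  \<open>[xgrid m k, xgrid m (k + 1)] \<times> [tgrid m l, tgrid m (l + 1)]\<close>; the timeslabs are indexed by \<open>l\<close>.\<close>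
record mesh =
  nx :: nat
  nt :: nat
  xgrid :: "nat \<Rightarrow> real"
  tgrid :: "nat \<Rightarrow> real"

definition cartesian_mesh :: "mesh \<Rightarrow> real \<Rightarrow> real \<Rightarrow> real \<Rightarrow> bool" where
  "cartesian_mesh m xL xR T \<longleftrightarrow>
     nx m \<ge> 1 \<and> nt m \<ge> 1 \<and>
     xgrid m 0 = xL \<and> xgrid m (nx m) = xR \<and> (\<forall>k < nx m. xgrid m k < xgrid m (k + 1)) \<and>
     tgrid m 0 = 0 \<and> tgrid m (nt m) = T \<and> (\<forall>l < nt m. tgrid m l < tgrid m (l + 1))"

definition dx :: "mesh \<Rightarrow> nat \<Rightarrow> real" where
  "dx m k = xgrid m (k + 1) - xgrid m k"

definition dt :: "mesh \<Rightarrow> nat \<Rightarrow> real" where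
  "dt m l = tgrid m (l + 1) - tgrid m l"

text \<open>Values attached to the elements \<open>(k, l)\<close> and states of the mesh: coefficients of the
  solution, or numerical fluxes at the \<^term>\<open>4 * n_face d\<close> face nodes.\<close>
type_synonym 's field = "nat \<Rightarrow> nat \<Rightarrow> 's coeffs"

text \<open>The block of face \<open>i \<in> {1, 2, 3, 4}\<close> of a vector of values at all face nodes.\<close>
definition on_face :: "disc \<Rightarrow> nat \<Rightarrow> real vec \<Rightarrow> real vec" where
  "on_face d i f = vec (n_face d) (\<lambda>j. f $ ((i - 1) * n_face d + j))"

text \<open>Neighbouring elements share their interface values, periodically in space.\<close>
definition interface_single_valued :: "disc \<Rightarrow> mesh \<Rightarrow> 's field \<Rightarrow> bool" where
  "interface_single_valued d m f \<longleftrightarrow>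
     (\<forall>k < nx m. \<forall>l < nt m. \<forall>a.
        on_face d 2 (f k l a) = on_face d 1 (f ((k + 1) mod nx m) l a)) \<and>
     (\<forall>k < nx m. \<forall>l. l + 1 < nt m \<longrightarrow> (\<forall>a.
        on_face d 4 (f k l a) = on_face d 3 (f k (l + 1) a)))"

definition initial_data :: "disc \<Rightarrow> mesh \<Rightarrow> (real \<Rightarrow> real ^ 's) \<Rightarrow> ('s::finite) field \<Rightarrow> bool" where
  "initial_data d m u0 ft \<longleftrightarrow>
     (\<forall>k < nx m. \<forall>a. on_face d 3 (ft k 0 a) =
        vec (n_face d) (\<lambda>j. jac1 (dx m k) (dt m 0) *
          vec_nth (u0 (xgrid m k + (1 + face_nodes d ! j) / 2 * dx m k)) a))"

definition outflow :: "('s::finite) law \<Rightarrow> disc \<Rightarrow> mesh \<Rightarrow> 's field \<Rightarrow> 's field \<Rightarrow> bool" where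
  "outflow L d m u ft \<longleftrightarrow>
     (let l = nt m - 1 in \<forall>k < nx m. \<forall>a. on_face d 4 (ft k l a) =
        vec (n_face d) (\<lambda>j. jac1 (dx m k) (dt m l) *
          vec_nth (utilde L d (dx m k) (dt m l) (u k l) (n_quad d + 3 * n_face d + j)) a))"

definition st_nsfr_solution ::
    "('s::finite) law \<Rightarrow> disc \<Rightarrow> mesh \<Rightarrow> 's field \<Rightarrow> 's field \<Rightarrow> 's field \<Rightarrow> bool" where
  "st_nsfr_solution L d m u ft fs \<longleftrightarrow>
     (\<forall>k < nx m. \<forall>l < nt m.
        admissible L d (dx m k) (dt m l) (u k l) \<and>
        (\<forall>a. u k l a \<in> carrier_vec (n_soln d) \<and>
             ft k l a \<in> carrier_vec (4 * n_face d) \<and>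
             fs k l a \<in> carrier_vec (4 * n_face d) \<and>
             residual L d (dx m k) (dt m l) (u k l) a (ft k l a) (fs k l a) = 0\<^sub>v (n_soln d)))"

end

theory Submission
  imports Defs "Jordan_Normal_Form.Determinant"
begin

text \<open>Test the scheme on one element with the constant function, that is, multiply the residual from the
  left by \<open>\<one> M\<close>, where \<open>\<one>\<close> is the row of ones. By the partition of unity
  \<open>\<chi> \<one>\<^sup>T = \<one>\<^sup>T\<close> at arbitrary points (\<open>chi_ones\<close>), the coefficient vector \<open>\<one>\<close> represents the
  constant function 1, and three things happen.

  \<^item> The inverses disappear. For the temporal terms \<open>\<one> M M\<^sup>-\<^sup>1 = \<one>\<close>. For the spatial terms, the
    \<open>p\<close>-th derivative of a constant vanishes for \<open>p \<ge> 1\<close>, so \<open>K \<one>\<^sup>T = 0\<close> whatever the value of \<open>c\<close>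
    (\<open>fr_mat_ones\<close>); as \<open>M\<close> and \<open>K\<close> are symmetric, \<open>\<one> M = \<one> (M + K)\<close> and therefore
    \<open>\<one> M (M + K)\<^sup>-\<^sup>1 = \<one>\<close> (\<open>ones_mass_inverse\<close>).
  \<^item> Each volume term becomes the sum of all entries of a skew-symmetric matrix multiplied entrywise
    by a symmetric one, which is zero (\<open>volume_term_vanishes\<close>).
  \<^item> Each lifting term becomes the quadrature of the numerical flux over the boundary, weighted with
    the normal (\<open>boundary_sum\<close>).

  What remains is the balance of the four face integrals of an element (\<open>element_balance\<close>). Summed
  over a timeslab, the spatial contributions cancel periodically, so the temporal flux through the top of
  the slab equals the one through its bottom; single-valuedness carries it from one slab to the next.

  Two points need more than linear algebra. Partition of unity requires that the rules really
  have \<open>n\<close> distinct nodes; repeated use of Rolle's theorem on Rodrigues' formula provides enough roots of the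
  Legendre polynomials and their derivatives (\<open>length_nodes\<close>). And only \<open>M + K\<close> is
  given to be invertible, whereas the temporal terms contain \<open>M\<^sup>-\<^sup>1\<close>. The
  tensor structure transfers invertibility: with the one-dimensional Gram matrix \<open>G\<close>,
  \<open>M = J (G \<otimes> G)\<close>, and \<open>K = X \<otimes> G\<close> for some \<open>X\<close>, because \<open>K\<close> differentiates in space only. So
  \<open>M + K = (J G + X) \<otimes> G\<close>, and its invertibility forces that of \<open>G\<close>, hence of \<open>M\<close>
  (\<open>mass_invertible\<close>).\<close>

section \<open>Roots of Legendre polynomials\<close>

text \<open>Rolle's theorem between consecutive elements of \<open>S\<close>, from left to right.\<close>
lemma pderiv_roots_between:
  fixes q :: "real poly"
  assumes "finite S" "S \<subseteq> {a..b}" "card S = Suc m" "\<And>x. x \<in> S \<Longrightarrow> poly q x = 0"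
  shows "\<exists>S' \<subseteq> {a<..<b}. finite S' \<and> card S' = m \<and> (\<forall>x\<in>S'. poly (pderiv q) x = 0)"
  using assms
proof (induction m arbitrary: S b)
  case 0
  then show ?case by (intro exI[of _ "{}"]) auto
next
  case (Suc m)
  define M where "M = Max S"
  define R where "R = S - {M}"
  define M' where "M' = Max R"
  have "S \<noteq> {}" using Suc.prems(3) by auto
  then have M: "M \<in> S" "\<And>x. x \<in> S \<Longrightarrow> x \<le> M"
    using Suc.prems(1) unfolding M_def by auto
  have R: "finite R" "card R = Suc m"
    using Suc.prems(1,3) M(1) unfolding R_def by auto
  then have "R \<noteq> {}" by auto
  then have M': "M' \<in> R" "\<And>x. x \<in> R \<Longrightarrow> x \<le> M'"
    using R(1) unfolding M'_def by auto
  have RS: "R \<subseteq> S" by (auto simp: R_def)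
  have "M' < M" using M M' RS unfolding R_def by (metis DiffE in_mono insertI1 less_eq_real_def)
  have "R \<subseteq> {a..M'}" using M' RS Suc.prems(2) by auto
  then obtain T where T: "T \<subseteq> {a<..<M'}" "finite T" "card T = m"
      "\<forall>x\<in>T. poly (pderiv q) x = 0"
    using Suc.IH[OF R(1) _ R(2)] Suc.prems(4) RS by blast
  obtain z where z: "M' < z" "z < M" "poly (pderiv q) z = 0"
    using poly_MVT[OF \<open>M' < M\<close>, of q] Suc.prems(4)[OF M(1)] Suc.prems(4)[of M'] M'(1) RS \<open>M' < M\<close>
    by auto
  have "a \<le> M'" "M \<le> b" using M M' RS Suc.prems(2) by auto
  then have "insert z T \<subseteq> {a<..<b}" using T(1) z by auto
  moreover have "card (insert z T) = Suc m" using T z by (subst card_insert_disjoint) auto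
  ultimately show ?case using T z by (intro exI[of _ "insert z T"]) auto
qed

text \<open>Each differentiation costs one factor \<open>x\<^sup>2 - 1\<close>. Hence derivatives of order below \<open>n\<close> still vanish
  at the end points \<open>-1\<close> and \<open>1\<close>.\<close>
lemma rodrigues_factor:
  assumes "k \<le> n"
  shows "[:-1, 0, 1:] ^ (n - k) dvd (pderiv ^^ k) ([:-1, 0, 1:] ^ n :: real poly)"
  using assms
proof (induction k)
  case (Suc k)
  let ?w = "[:-1, 0, 1:] :: real poly"
  obtain g where g: "(pderiv ^^ k) (?w ^ n) = ?w ^ (n - k) * g"
    using Suc by (auto elim: dvdE)
  have nk: "n - k = Suc (n - Suc k)" using Suc.prems by simp
  have "(pderiv ^^ Suc k) (?w ^ n) = pderiv (?w ^ Suc (n - Suc k) * g)"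
    using g nk by simp
  also have "\<dots> = ?w ^ (n - Suc k) *
      (?w * pderiv g + Polynomial.smult (of_nat (Suc (n - Suc k))) (pderiv ?w) * g)"
    unfolding pderiv_mult pderiv_power_Suc by (simp add: algebra_simps)
  finally show ?case by simp
qed auto

text \<open>Every derivative gains one interior root: Rolle's theorem is applied to the interior roots of the
  previous derivative together with the two end points.\<close>
lemma rodrigues_roots:
  assumes "k \<le> n"
  shows "\<exists>S \<subseteq> {-1<..<1}. finite S \<and> card S = k \<and>
    (\<forall>x\<in>S. poly ((pderiv ^^ k) ([:-1, 0, 1:] ^ n :: real poly)) x = 0)"
  using assms
proof (induction k)
  case 0
  then show ?case by (intro exI[of _ "{}"]) auto
next
  case (Suc k)
  let ?f = "(pderiv ^^ k) ([:-1, 0, 1:] ^ n :: real poly)"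
  obtain S where S: "S \<subseteq> {-1<..<1}" "finite S" "card S = k" "\<forall>x\<in>S. poly ?f x = 0"
    using Suc by auto
  have "[:-1, 0, 1:] dvd ([:-1, 0, 1:] :: real poly) ^ (n - k)"
    using Suc.prems by (intro dvd_power) auto
  also have "\<dots> dvd ?f" using rodrigues_factor[of k n] Suc.prems by simp
  finally have ends: "poly ?f (-1) = 0" "poly ?f 1 = 0" by (auto elim!: dvdE)
  (* k interior roots and two end points: k + 2 roots, hence k + 1 roots of the next derivative *)
  have "card ({-1, 1} \<union> S) = Suc (Suc k)"
    using S by (subst card_Un_disjoint) auto
  moreover have "{-1, 1} \<union> S \<subseteq> {-1..1}" using S(1) by auto
  moreover have "\<And>x. x \<in> {-1, 1} \<union> S \<Longrightarrow> poly ?f x = 0" using S(4) ends by blast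
  ultimately have "\<exists>T \<subseteq> {-1<..<1}. finite T \<and> card T = Suc k \<and> (\<forall>x\<in>T. poly (pderiv ?f) x = 0)"
    using S(2) by (intro pderiv_roots_between[of "{-1, 1} \<union> S"]) simp_all
  then show ?case by simp
qed

lemma degree_pderiv_funpow: "degree ((pderiv ^^ k) (q :: real poly)) = degree q - k"
  by (induction k) (auto simp: degree_pderiv)

lemma degree_legendre: "degree (legendre n) = n"
proof -
  have "degree ([:-1, 0, 1:] ^ n :: real poly) = 2 * n"
    by (simp add: degree_power_eq)
  then show ?thesis by (simp add: legendre_def degree_pderiv_funpow)
qed

lemma legendre_nonzero: "legendre n \<noteq> 0"
proof (cases "n = 0")
  case True
  then show ?thesis by (simp add: legendre_def)
next
  case False
  then show ?thesis using degree_legendre[of n] by auto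
qed

lemma legendre_roots:
  "\<exists>S \<subseteq> {-1<..<1}. finite S \<and> card S = n \<and> (\<forall>x\<in>S. poly (legendre n) x = 0)"
  using rodrigues_roots[of n n] by (auto simp: legendre_def)

lemma card_roots_eqI:
  fixes q :: "real poly"
  assumes "q \<noteq> 0" "degree q \<le> n" "finite S" "card S = n" "\<forall>x\<in>S. poly q x = 0"
  shows "card {x. poly q x = 0} = n"
proof (rule antisym)
  show "card {x. poly q x = 0} \<le> n" using card_poly_roots_bound[OF assms(1)] assms(2) by simp
  show "n \<le> card {x. poly q x = 0}"
    using card_mono[of "{x. poly q x = 0}" S] assms poly_roots_finite[OF assms(1)] by auto
qed

text \<open>The node lists are defined as sorted sets of roots, so their length is a fact about Legendre
  polynomials. For the Lobatto rule, \<open>n - 2\<close> nodes are roots of the derivative of the Legendre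
  polynomial of degree \<open>n - 1\<close> between its roots, and the others are the end points.\<close>
lemma length_nodes:
  assumes "n \<ge> 2"
  shows "length (nodes r n) = n"
proof (cases r)
  case GL
  obtain S where "finite S" "card S = n" "\<forall>x\<in>S. poly (legendre n) x = 0"
    using legendre_roots by blast
  then have "card {x. poly (legendre n) x = 0} = n"
    by (intro card_roots_eqI) (auto simp: legendre_nonzero degree_legendre)
  then show ?thesis using GL by simp
next
  case GLL
  define m where "m = n - 2"
  have m: "n = Suc (Suc m)" using assms by (simp add: m_def)
  let ?P = "legendre (Suc m)" and ?q = "[:1, 0, -1:] * pderiv (legendre (Suc m))"
  obtain S where S: "S \<subseteq> {-1<..<1}" "finite S" "card S = Suc m" "\<forall>x\<in>S. poly ?P x = 0"
    using legendre_roots by blast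
  have "S \<subseteq> {-1..1}" using S(1) by auto
  then obtain T where T: "T \<subseteq> {-1<..<1}" "finite T" "card T = m" "\<forall>x\<in>T. poly (pderiv ?P) x = 0"
    using pderiv_roots_between[of S "-1" 1 m ?P] S by blast
  have "pderiv ?P \<noteq> 0" using degree_legendre[of "Suc m"] by (auto simp: pderiv_eq_0_iff)
  then have "?q \<noteq> 0" by (simp only: mult_eq_0_iff) simp
  have "degree ?q \<le> degree ([:1, 0, -1:] :: real poly) + degree (pderiv ?P)"
    by (rule degree_mult_le)
  also have "\<dots> = n" using m by (simp add: degree_pderiv degree_legendre)
  finally have "degree ?q \<le> n" .
  have "card ({-1, 1} \<union> T) = n"
    using T m by (subst card_Un_disjoint) auto
  moreover have "\<forall>x\<in>{-1, 1} \<union> T. poly ?q x = 0" using T by auto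
  ultimately have "card {x. poly ?q x = 0} = n"
    using T(2) \<open>?q \<noteq> 0\<close> \<open>degree ?q \<le> n\<close> by (intro card_roots_eqI[of ?q n "{-1, 1} \<union> T"]) auto
  then show ?thesis using GLL m by simp
qed

lemma distinct_nodes: "distinct (nodes r n)"
  by (cases r) auto

section \<open>Lagrange polynomials\<close>

lemma poly_lagrange_node:
  assumes "distinct xs" "i < length xs" "j < length xs"
  shows "poly (lagrange xs i) (xs ! j) = (if i = j then 1 else 0)"
proof (cases "i = j")
  case True
  have "xs ! j / (xs ! j - xs ! k) - xs ! k / (xs ! j - xs ! k) = 1"
    if "k < length xs" "k \<noteq> j" for k
    using that assms by (simp add: diff_divide_distrib[symmetric] nth_eq_iff_index_eq)
  then show ?thesis using True by (auto simp: lagrange_def poly_prod intro!: prod.neutral)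
next
  case False
  then show ?thesis using assms
    by (auto simp: lagrange_def poly_prod intro!: prod_zero bexI[of _ j])
qed

lemma degree_lagrange:
  assumes "i < length xs"
  shows "degree (lagrange xs i) < length xs"
proof -
  have "degree (lagrange xs i) \<le> (\<Sum>j \<in> {..<length xs} - {i}. 1)"
    unfolding lagrange_def
    by (rule order.trans[OF degree_prod_sum_le sum_mono]) (auto intro: order.trans[OF degree_smult_le])
  then show ?thesis using assms by auto
qed

text \<open>Both sides have degree less than the number of nodes and agree at all nodes.\<close>
lemma lagrange_partition_of_unity:
  assumes "distinct xs" "xs \<noteq> []"
  shows "(\<Sum>i<length xs. lagrange xs i) = 1"
proof (rule poly_eqI_degree)
  fix x assume "x \<in> set xs"
  then obtain j where j: "j < length xs" "x = xs ! j" by (metis in_set_conv_nth)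
  show "poly (\<Sum>i<length xs. lagrange xs i) x = poly 1 x"
    using j assms by (simp add: poly_sum poly_lagrange_node)
next
  have "degree (\<Sum>i<length xs. lagrange xs i) \<le> length xs - 1"
  proof (rule degree_sum_le)
    fix i assume "i \<in> {..<length xs}"
    then show "degree (lagrange xs i) \<le> length xs - 1" using degree_lagrange[of i xs] by simp
  qed simp
  moreover have "0 < length xs" using assms(2) by simp
  ultimately show "degree (\<Sum>i<length xs. lagrange xs i) < card (set xs)"
    unfolding distinct_card[OF assms(1)] by linarith
  show "degree (1 :: real poly) < card (set xs)" using assms by (simp add: distinct_card)
qed

section \<open>Kronecker products\<close>

lemma sum_mod_div:
  fixes h :: "nat \<Rightarrow> nat \<Rightarrow> 'a :: comm_monoid_add"
  shows "(\<Sum>k<m * n. h (k mod m) (k div m)) = (\<Sum>i<m. \<Sum>j<n. h i j)"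
proof (cases "m = 0")
  case False
  have "(\<Sum>k<m * n. h (k mod m) (k div m)) = (\<Sum>(i, j)\<in>{..<m} \<times> {..<n}. h i j)"
  proof (rule sum.reindex_bij_witness[where i = "\<lambda>(i, j). i + m * j" and j = "\<lambda>k. (k mod m, k div m)"])
    fix b assume b: "b \<in> {..<m} \<times> {..<n}"
    obtain i j where ij: "b = (i, j)" "i < m" "j < n" using b by auto
    have "i + m * j < m * Suc j" using ij by simp
    also have "\<dots> \<le> m * n" using ij by (intro mult_le_mono2) simp
    finally show "(case b of (i, j) \<Rightarrow> i + m * j) \<in> {..<m * n}" using ij by simp
    show "((case b of (i, j) \<Rightarrow> i + m * j) mod m, (case b of (i, j) \<Rightarrow> i + m * j) div m) = b"
      using ij by simp
  qed (use False in \<open>auto simp: mult.commute[of m n] intro: less_mult_imp_div_less\<close>)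
  then show ?thesis by (simp add: sum.cartesian_product)
qed simp

text \<open>The first factor belongs to the fast index \<open>i mod _\<close>, the second to the slow index \<open>i div _\<close>. This is the
  numbering of tensor-product nodes and basis functions, so the first factor acts in \<open>\<xi>\<close> and
  the second in \<open>\<tau>\<close>; it is the reverse of the usual row-major convention.\<close>
definition kron :: "'a :: semiring_1 mat \<Rightarrow> 'a mat \<Rightarrow> 'a mat" where
  "kron A B = mat (dim_row A * dim_row B) (dim_col A * dim_col B)
     (\<lambda>(i, j). A $$ (i mod dim_row A, j mod dim_col A) * B $$ (i div dim_row A, j div dim_col A))"

lemma mod_div_less:
  fixes i m n :: nat
  assumes "i < m * n"
  shows "i mod m < m" "i div m < n"
proof -
  have "0 < m" using assms by (cases m) auto
  then show "i mod m < m" by simp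
  show "i div m < n" using assms by (simp add: less_mult_imp_div_less mult.commute)
qed

lemma kron_carrier [simp, intro]:
  "A \<in> carrier_mat a b \<Longrightarrow> B \<in> carrier_mat c e \<Longrightarrow> kron A B \<in> carrier_mat (a * c) (b * e)"
  by (auto simp: kron_def)

lemma kron_dim [simp]:
  "dim_row (kron A B) = dim_row A * dim_row B" "dim_col (kron A B) = dim_col A * dim_col B"
  by (auto simp: kron_def)

lemma kron_index:
  assumes "A \<in> carrier_mat a b" "B \<in> carrier_mat c e" "i < a * c" "j < b * e"
  shows "kron A B $$ (i, j) = A $$ (i mod a, j mod b) * B $$ (i div a, j div b)"
  using assms by (auto simp: kron_def)

lemma mat_mult_index:
  assumes "A \<in> carrier_mat a b" "B \<in> carrier_mat b c" "i < a" "j < c"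
  shows "(A * B) $$ (i, j) = (\<Sum>k<b. A $$ (i, k) * B $$ (k, j))"
  using assms by (auto simp: scalar_prod_def atLeast0LessThan)

text \<open>The mixed product rule: it reduces operators on the tensor-product space to operators in one
  variable.\<close>
lemma kron_mult:
  fixes A B C D :: "'a :: comm_semiring_1 mat"
  assumes A: "A \<in> carrier_mat a b" and B: "B \<in> carrier_mat a' b'"
    and C: "C \<in> carrier_mat b c" and D: "D \<in> carrier_mat b' c'"
  shows "kron A B * kron C D = kron (A * C) (B * D)"
proof (rule eq_matI)
  fix i j assume "i < dim_row (kron (A * C) (B * D))" "j < dim_col (kron (A * C) (B * D))"
  then have i: "i < a * a'" and j: "j < c * c'" using assms by auto
  note i' = mod_div_less[OF i] and j' = mod_div_less[OF j]
  have "(kron A B * kron C D) $$ (i, j) = (\<Sum>k<b * b'. kron A B $$ (i, k) * kron C D $$ (k, j))"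
    by (rule mat_mult_index[OF kron_carrier[OF A B] kron_carrier[OF C D] i j])
  also have "\<dots> = (\<Sum>k<b * b'. (\<lambda>r s. (A $$ (i mod a, r) * C $$ (r, j mod c)) *
      (B $$ (i div a, s) * D $$ (s, j div c))) (k mod b) (k div b))"
    by (intro sum.cong refl)
       (simp add: kron_index[OF A B i] kron_index[OF C D _ j] algebra_simps)
  also have "\<dots> = (\<Sum>r<b. \<Sum>s<b'. (A $$ (i mod a, r) * C $$ (r, j mod c)) *
      (B $$ (i div a, s) * D $$ (s, j div c)))"
    by (rule sum_mod_div)
  also have "\<dots> = (A * C) $$ (i mod a, j mod c) * (B * D) $$ (i div a, j div c)"
    unfolding mat_mult_index[OF A C i'(1) j'(1)] mat_mult_index[OF B D i'(2) j'(2)]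
    by (rule sum_product[symmetric])
  also have "\<dots> = kron (A * C) (B * D) $$ (i, j)"
    by (rule kron_index[symmetric, OF mult_carrier_mat[OF A C] mult_carrier_mat[OF B D] i j])
  finally show "(kron A B * kron C D) $$ (i, j) = kron (A * C) (B * D) $$ (i, j)" .
qed (use assms in auto)

lemma kron_mat_diag:
  fixes f g :: "nat \<Rightarrow> 'a :: semiring_1"
  shows "kron (mat_diag a f) (mat_diag b g) = mat_diag (a * b) (\<lambda>i. f (i mod a) * g (i div a))"
proof (rule eq_matI)
  fix i j assume "i < dim_row (mat_diag (a * b) (\<lambda>i. f (i mod a) * g (i div a)))"
    "j < dim_col (mat_diag (a * b) (\<lambda>i. f (i mod a) * g (i div a)))"
  then have i: "i < a * b" and j: "j < a * b" by (auto simp: mat_diag_def)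
  have "i = j \<longleftrightarrow> i mod a = j mod a \<and> i div a = j div a"
    by (metis div_mult_mod_eq)
  then show "kron (mat_diag a f) (mat_diag b g) $$ (i, j)
      = mat_diag (a * b) (\<lambda>i. f (i mod a) * g (i div a)) $$ (i, j)"
    unfolding kron_index[OF mat_diag_dim mat_diag_dim i j]
    using i j mod_div_less[OF i] mod_div_less[OF j] by (auto simp: mat_diag_def)
qed (auto simp: mat_diag_def)

lemma kron_one: "kron (1\<^sub>m a) (1\<^sub>m b) = (1\<^sub>m (a * b) :: 'a :: semiring_1 mat)"
  using kron_mat_diag[of a "\<lambda>_. 1" b "\<lambda>_. 1"] by (simp add: mat_diag_one)

lemma kron_transpose: "transpose_mat (kron A B) = kron (transpose_mat A) (transpose_mat B)"
  by (rule eq_matI) (auto simp: kron_def mod_div_less)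

lemma kron_smult_left: "kron (c \<cdot>\<^sub>m A) B = c \<cdot>\<^sub>m kron A B"
proof (rule eq_matI)
  fix i j assume "i < dim_row (c \<cdot>\<^sub>m kron A B)" "j < dim_col (c \<cdot>\<^sub>m kron A B)"
  then have i: "i < dim_row A * dim_row B" and j: "j < dim_col A * dim_col B" by auto
  then show "kron (c \<cdot>\<^sub>m A) B $$ (i, j) = (c \<cdot>\<^sub>m kron A B) $$ (i, j)"
    using mod_div_less(1)[OF i] mod_div_less(1)[OF j] by (simp add: kron_def mult.assoc)
qed auto

lemma kron_add_left:
  assumes "A \<in> carrier_mat a b" "C \<in> carrier_mat a b"
  shows "kron A B + kron C B = kron (A + C) B"
  using assms by (intro eq_matI) (auto simp: kron_def mod_div_less algebra_simps)

lemma kron_pow: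
  fixes A B :: "'a :: comm_semiring_1 mat"
  assumes A: "A \<in> carrier_mat a a" and B: "B \<in> carrier_mat b b"
  shows "kron A B ^\<^sub>m k = kron (A ^\<^sub>m k) (B ^\<^sub>m k)"
proof (induction k)
  case 0
  then show ?case using assms by (simp add: kron_one)
next
  case (Suc k)
  then show ?case
    using kron_mult[OF pow_carrier_mat[OF A, of k] pow_carrier_mat[OF B, of k] A B] by simp
qed

section \<open>Inverses\<close>

lemma mat_inv_right:
  assumes A: "A \<in> carrier_mat n n" and inv: "invertible_mat A"
  shows "mat_inv A \<in> carrier_mat n n" "A * mat_inv A = 1\<^sub>m n"
proof -
  obtain B where AB: "A * B = 1\<^sub>m n" and BA: "B * A = 1\<^sub>m (dim_row B)"
    using A inv unfolding invertible_mat_def inverts_mat_def by auto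
  have B: "B \<in> carrier_mat n n"
    using A arg_cong[OF AB, of dim_col] arg_cong[OF BA, of dim_col] by auto
  then have "A \<in> Units (ring_mat TYPE(real) n ())"
    using A AB BA by (auto simp: Units_def ring_mat_simps)
  then have "mat_inverse A \<noteq> None" using mat_inverse(1)[OF A, of "()"] by blast
  then obtain C where "mat_inverse A = Some C" by auto
  with mat_inverse(2)[OF A this]
  show "mat_inv A \<in> carrier_mat n n" "A * mat_inv A = 1\<^sub>m n" by (auto simp: mat_inv_def)
qed

lemma invertible_matI_right:
  fixes A :: "'a :: field mat"
  assumes "A \<in> carrier_mat n n" "B \<in> carrier_mat n n" "A * B = 1\<^sub>m n"
  shows "invertible_mat A"
  using assms mat_mult_left_right_inverse[OF assms]
  unfolding invertible_mat_def inverts_mat_def by auto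

text \<open>If \<open>B v = 0\<close>, then \<open>\<one> \<otimes> v\<close> lies in the kernel of \<open>A \<otimes> B\<close>, for every \<open>A\<close>.\<close>
lemma kron_right_factor_invertible:
  fixes A B :: "real mat"
  assumes A: "A \<in> carrier_mat n n" and B: "B \<in> carrier_mat m m" and "0 < n"
    and inv: "invertible_mat (kron A B)"
  shows "\<exists>C \<in> carrier_mat m m. B * C = 1\<^sub>m m"
proof -
  have "det B \<noteq> 0"
  proof
    assume "det B = 0"
    then obtain v where v: "v \<in> carrier_vec m" "v \<noteq> 0\<^sub>v m" "B *\<^sub>v v = 0\<^sub>v m"
      using det_0_iff_vec_prod_zero[OF B] by blast
    (* the vector of ones in the first index, v in the second *)
    define w where "w = vec (n * m) (\<lambda>i. v $ (i div n))"
    have w: "w \<in> carrier_vec (n * m)" by (simp add: w_def)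
    have Bv: "(\<Sum>s<m. B $$ (r, s) * v $ s) = 0" if "r < m" for r
      using arg_cong[OF v(3), of "\<lambda>x. x $ r"] that B v(1)
      by (simp add: scalar_prod_def atLeast0LessThan)
    have "kron A B *\<^sub>v w = 0\<^sub>v (n * m)"
    proof (rule eq_vecI)
      fix i assume "i < dim_vec (0\<^sub>v (n * m) :: real vec)"
      then have i: "i < n * m" by simp
      have "(kron A B *\<^sub>v w) $ i = (\<Sum>k<n * m. kron A B $$ (i, k) * w $ k)"
        using i A B w by (simp add: scalar_prod_def atLeast0LessThan)
      also have "\<dots> = (\<Sum>k<n * m. (\<lambda>r s. A $$ (i mod n, r) * (B $$ (i div n, s) * v $ s)) (k mod n) (k div n))"
        by (intro sum.cong refl) (simp add: kron_index[OF A B i] w_def)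
      also have "\<dots> = (\<Sum>r<n. A $$ (i mod n, r)) * (\<Sum>s<m. B $$ (i div n, s) * v $ s)"
        by (subst sum_mod_div) (simp add: sum_product)
      finally show "(kron A B *\<^sub>v w) $ i = 0\<^sub>v (n * m) $ i"
        using Bv[OF mod_div_less(2)[OF i]] i by simp
    qed (use A B in auto)
    moreover have "mat_inv (kron A B) * kron A B = 1\<^sub>m (n * m)"
      using mat_mult_left_right_inverse[OF kron_carrier[OF A B] mat_inv_right[OF kron_carrier[OF A B] inv]] .
    ultimately have "w = 0\<^sub>v (n * m)"
      using assoc_mult_mat_vec[OF mat_inv_right(1)[OF kron_carrier[OF A B] inv] kron_carrier[OF A B] w]
        mat_inv_right(1)[OF kron_carrier[OF A B] inv] w by auto
    have "v = 0\<^sub>v m"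
    proof (rule eq_vecI)
      fix j assume "j < dim_vec (0\<^sub>v m :: real vec)"
      then have j: "j < m" by simp
      have "n * j < n * m" using j \<open>0 < n\<close> by simp
      then show "v $ j = 0\<^sub>v m $ j"
        using arg_cong[OF \<open>w = 0\<^sub>v (n * m)\<close>, of "\<lambda>x. x $ (n * j)"] j \<open>0 < n\<close> by (simp add: w_def)
    qed (use v in auto)
    then show False using v(2) by simp
  qed
  then have "B \<in> Units (ring_mat TYPE(real) m ())" by (rule det_non_zero_imp_unit[OF B])
  then show ?thesis by (auto simp: Units_def ring_mat_simps)
qed

section \<open>Tensor structure of the operators\<close>

definition vander :: "disc \<Rightarrow> real mat" where
  "vander d = mat (n_face d) (deg d + 1)
     (\<lambda>(i, j). poly (lagrange (nodes (soln_rule d) (deg d + 1)) j) (face_nodes d ! i))"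

definition deriv_1d :: "disc \<Rightarrow> real mat" where
  "deriv_1d d = mat (deg d + 1) (deg d + 1)
     (\<lambda>(i, j). poly (pderiv (lagrange (nodes (soln_rule d) (deg d + 1)) j))
        (nodes (soln_rule d) (deg d + 1) ! i))"

text \<open>The one-dimensional mass matrix, computed with the flux quadrature rule and without Jacobian.\<close>
definition gram_1d :: "disc \<Rightarrow> real mat" where
  "gram_1d d = transpose_mat (vander d) * W_face d * vander d"

lemma length_weights [simp]: "length (weights r n) = n"
  by (simp add: weights_def)

lemma vander_carrier: "vander d \<in> carrier_mat (n_face d) (deg d + 1)"
  by (simp add: vander_def)

lemma deriv_1d_carrier: "deriv_1d d \<in> carrier_mat (deg d + 1) (deg d + 1)"
  by (simp add: deriv_1d_def)

lemma W_face_carrier: "W_face d \<in> carrier_mat (n_face d) (n_face d)"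
  by (simp add: W_face_def diag_of_def)

lemma gram_1d_carrier: "gram_1d d \<in> carrier_mat (deg d + 1) (deg d + 1)"
  using vander_carrier[of d] W_face_carrier[of d] by (simp add: gram_1d_def)

lemma length_tensor_pts [simp]: "length (tensor_pts r n) = n * n"
  by (simp add: tensor_pts_def)

lemma nth_tensor_pts:
  assumes "i < n * n"
  shows "tensor_pts r n ! i = (nodes r n ! (i mod n), nodes r n ! (i div n))"
  using assms by (simp add: tensor_pts_def)

lemma length_vol_pts [simp]: "length (vol_pts d) = n_quad d"
  by (simp add: vol_pts_def n_quad_def)

lemma W_q_kron: "W_q d = kron (W_face d) (W_face d)"
  unfolding W_q_def W_face_def diag_of_def kron_mat_diag length_weights
  by (rule eq_matI) (auto simp: tensor_weights_def mat_diag_def)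

lemma chi_vol_kron: "chi d (vol_pts d) = kron (vander d) (vander d)"
proof (rule eq_matI)
  fix i j assume "i < dim_row (kron (vander d) (vander d))" "j < dim_col (kron (vander d) (vander d))"
  then have i: "i < n_face d * n_face d" and j: "j < (deg d + 1) * (deg d + 1)"
    using vander_carrier[of d] by auto
  have "chi d (vol_pts d) $$ (i, j) = basis (soln_rule d) (deg d + 1) j (vol_pts d ! i)"
    using i j by (simp only: chi_def eval_mat_def index_mat length_vol_pts n_soln_def n_quad_def case_prod_conv)
  also have "\<dots> = vander d $$ (i mod n_face d, j mod (deg d + 1)) * vander d $$ (i div n_face d, j div (deg d + 1))"
    using mod_div_less[OF i] mod_div_less[OF j]
    by (simp only: vol_pts_def nth_tensor_pts[OF i] basis_def vander_def index_mat case_prod_conv face_nodes_def)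
  also have "\<dots> = kron (vander d) (vander d) $$ (i, j)"
    by (rule kron_index[symmetric, OF vander_carrier vander_carrier i j])
  finally show "chi d (vol_pts d) $$ (i, j) = kron (vander d) (vander d) $$ (i, j)" .
qed (auto simp: chi_def eval_mat_def n_soln_def n_quad_def vander_def)

text \<open>The second factor is the identity because the solution basis is cardinal at the solution nodes.\<close>
lemma D_xi_kron:
  assumes "deg d \<ge> 1"
  shows "D_xi d = kron (deriv_1d d) (1\<^sub>m (deg d + 1))"
proof (rule eq_matI)
  let ?n = "deg d + 1"
  fix i j assume "i < dim_row (kron (deriv_1d d) (1\<^sub>m ?n))" "j < dim_col (kron (deriv_1d d) (1\<^sub>m ?n))"
  then have i: "i < ?n * ?n" and j: "j < ?n * ?n"
    using deriv_1d_carrier[of d] by auto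
  have "length (nodes (soln_rule d) ?n) = ?n" using assms by (intro length_nodes) simp
  then have "poly (lagrange (nodes (soln_rule d) ?n) (j div ?n)) (nodes (soln_rule d) ?n ! (i div ?n))
      = (if j div ?n = i div ?n then 1 else 0)"
    using mod_div_less(2)[OF i] mod_div_less(2)[OF j]
    by (intro poly_lagrange_node distinct_nodes) simp_all
  then have cardinal: "poly (lagrange (nodes (soln_rule d) ?n) (j div ?n)) (nodes (soln_rule d) ?n ! (i div ?n))
      = 1\<^sub>m ?n $$ (i div ?n, j div ?n)"
    using mod_div_less(2)[OF i] mod_div_less(2)[OF j] by auto
  have "D_xi d $$ (i, j) = basis_dxi (soln_rule d) ?n j (tensor_pts (soln_rule d) ?n ! i)"
    using i j by (simp only: D_xi_def eval_mat_def index_mat length_tensor_pts n_soln_def case_prod_conv)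
  also have "\<dots> = deriv_1d d $$ (i mod ?n, j mod ?n) * 1\<^sub>m ?n $$ (i div ?n, j div ?n)"
    using mod_div_less[OF i] mod_div_less[OF j]
    by (simp only: nth_tensor_pts[OF i] basis_dxi_def deriv_1d_def index_mat case_prod_conv cardinal)
  also have "\<dots> = kron (deriv_1d d) (1\<^sub>m ?n) $$ (i, j)"
    by (rule kron_index[symmetric, OF deriv_1d_carrier one_carrier_mat i j])
  finally show "D_xi d $$ (i, j) = kron (deriv_1d d) (1\<^sub>m ?n) $$ (i, j)" .
qed (auto simp: D_xi_def eval_mat_def n_soln_def deriv_1d_def)

lemma chi_carrier [simp]: "chi d pts \<in> carrier_mat (length pts) (n_soln d)"
  by (simp add: chi_def eval_mat_def)

lemma W_q_carrier: "W_q d \<in> carrier_mat (n_quad d) (n_quad d)"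
  by (simp add: W_q_def diag_of_def tensor_weights_def n_quad_def)

lemma mass_carrier: "mass d h k \<in> carrier_mat (n_soln d) (n_soln d)"
  using chi_carrier[of d "vol_pts d"] W_q_carrier[of d] by (auto simp: mass_def)

lemma D_xi_carrier: "D_xi d \<in> carrier_mat (n_soln d) (n_soln d)"
  by (simp add: D_xi_def eval_mat_def n_soln_def)

lemma fr_mat_carrier: "fr_mat d h k \<in> carrier_mat (n_soln d) (n_soln d)"
  using pow_carrier_mat[OF D_xi_carrier[of d], of "deg d"] mass_carrier[of d h k]
  by (auto simp: fr_mat_def)

lemma mass_kron: "mass d h k = kron (jac h k \<cdot>\<^sub>m gram_1d d) (gram_1d d)"
proof -
  let ?V = "vander d" and ?W = "W_face d"
  have V: "?V \<in> carrier_mat (n_face d) (deg d + 1)" by (rule vander_carrier)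
  have Vt: "transpose_mat ?V \<in> carrier_mat (deg d + 1) (n_face d)" using V by simp
  have W: "?W \<in> carrier_mat (n_face d) (n_face d)" by (rule W_face_carrier)
  have "mass d h k = kron (transpose_mat ?V) (transpose_mat ?V) * kron (jac h k \<cdot>\<^sub>m ?W) ?W * kron ?V ?V"
    by (simp add: mass_def chi_vol_kron W_q_kron kron_transpose kron_smult_left)
  also have "\<dots> = kron (transpose_mat ?V * (jac h k \<cdot>\<^sub>m ?W)) (transpose_mat ?V * ?W) * kron ?V ?V"
    using kron_mult[OF Vt Vt smult_carrier_mat[OF W] W] by simp
  also have "\<dots> = kron (transpose_mat ?V * (jac h k \<cdot>\<^sub>m ?W) * ?V) (transpose_mat ?V * ?W * ?V)"
    using kron_mult[OF mult_carrier_mat[OF Vt smult_carrier_mat[OF W]] mult_carrier_mat[OF Vt W] V V]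
    by simp
  also have "transpose_mat ?V * (jac h k \<cdot>\<^sub>m ?W) * ?V = jac h k \<cdot>\<^sub>m gram_1d d"
    using V Vt W mult_smult_distrib[OF Vt W] mult_smult_assoc_mat[OF mult_carrier_mat[OF Vt W] V]
    by (simp add: gram_1d_def)
  finally show ?thesis by (simp add: gram_1d_def)
qed

text \<open>The flux reconstruction matrix differentiates in \<open>\<xi>\<close> only, so in \<open>\<tau>\<close> it acts as the plain Gram matrix. The same second
  factor occurs in the mass matrix, so that the sum of both matrices is again a Kronecker product.\<close>
lemma fr_mat_kron:
  assumes "deg d \<ge> 1"
  shows "\<exists>X \<in> carrier_mat (deg d + 1) (deg d + 1). fr_mat d h k = kron X (gram_1d d)"
proof -
  let ?n = "deg d + 1" and ?G = "gram_1d d" and ?p = "deg d"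
  let ?P = "deriv_1d d ^\<^sub>m ?p"
  have G: "?G \<in> carrier_mat ?n ?n" by (rule gram_1d_carrier)
  have P: "?P \<in> carrier_mat ?n ?n" by (rule pow_carrier_mat[OF deriv_1d_carrier])
  have Pt: "transpose_mat ?P \<in> carrier_mat ?n ?n" using P by simp
  have I: "(1\<^sub>m ?n :: real mat) \<in> carrier_mat ?n ?n" by simp
  have "(1\<^sub>m ?n :: real mat) ^\<^sub>m k = 1\<^sub>m ?n" for k
    by (induction k) auto
  then have D: "D_xi d ^\<^sub>m ?p = kron ?P (1\<^sub>m ?n)"
    using kron_pow[OF deriv_1d_carrier I, of d ?p] by (simp add: D_xi_kron[OF assms])
  have "transpose_mat (D_xi d ^\<^sub>m ?p) * mass d h k * (D_xi d ^\<^sub>m ?p)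
      = kron (transpose_mat ?P) (1\<^sub>m ?n) * kron (jac h k \<cdot>\<^sub>m ?G) ?G * kron ?P (1\<^sub>m ?n)"
    unfolding D mass_kron by (simp add: kron_transpose)
  also have "\<dots> = kron (transpose_mat ?P * (jac h k \<cdot>\<^sub>m ?G)) ?G * kron ?P (1\<^sub>m ?n)"
    using kron_mult[OF Pt I smult_carrier_mat[OF G] G] left_mult_one_mat[OF G] by simp
  also have "\<dots> = kron (transpose_mat ?P * (jac h k \<cdot>\<^sub>m ?G) * ?P) ?G"
    using kron_mult[OF mult_carrier_mat[OF Pt smult_carrier_mat[OF G]] G P I]
      right_mult_one_mat[OF G] by simp
  finally have "fr_mat d h k = kron ((fr_param d / jac1 h k) \<cdot>\<^sub>m
      (transpose_mat ?P * (jac h k \<cdot>\<^sub>m ?G) * ?P)) ?G"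
    by (simp add: fr_mat_def kron_smult_left)
  moreover have "(fr_param d / jac1 h k) \<cdot>\<^sub>m (transpose_mat ?P * (jac h k \<cdot>\<^sub>m ?G) * ?P) \<in> carrier_mat ?n ?n"
    by (intro smult_carrier_mat mult_carrier_mat[OF mult_carrier_mat[OF Pt smult_carrier_mat[OF G]] P])
  ultimately show ?thesis by blast
qed

text \<open>The sum \<open>M + K = (J G + X) \<otimes> G\<close> is invertible only if \<open>G\<close> is, and then \<open>J\<^sup>-\<^sup>1 (G\<^sup>-\<^sup>1 \<otimes> G\<^sup>-\<^sup>1)\<close> is an inverse
  of \<open>M = J (G \<otimes> G)\<close>.\<close>
lemma mass_invertible:
  assumes p: "deg d \<ge> 1" and "0 < h" "0 < k"
    and inv: "invertible_mat (mass d h k + fr_mat d h k)"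
  shows "invertible_mat (mass d h k)"
proof -
  let ?n = "deg d + 1" and ?G = "gram_1d d"
  have G: "?G \<in> carrier_mat ?n ?n" by (rule gram_1d_carrier)
  have G': "jac h k \<cdot>\<^sub>m ?G \<in> carrier_mat ?n ?n" using G by simp
  obtain X where X: "X \<in> carrier_mat ?n ?n" "fr_mat d h k = kron X ?G"
    using fr_mat_kron[OF p] by blast
  have "invertible_mat (kron (jac h k \<cdot>\<^sub>m ?G + X) ?G)"
    using inv by (simp add: mass_kron X(2) kron_add_left[OF G' X(1)])
  then obtain H where H: "H \<in> carrier_mat ?n ?n" "?G * H = 1\<^sub>m ?n"
    using kron_right_factor_invertible[of "jac h k \<cdot>\<^sub>m ?G + X" ?n ?G ?n] G G' X(1) by auto
  have "jac h k \<noteq> 0" using assms by (simp add: jac_def)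
  moreover have "mass d h k = jac h k \<cdot>\<^sub>m kron ?G ?G" by (simp add: mass_kron kron_smult_left)
  moreover have "kron ?G ?G * kron H H = 1\<^sub>m (?n * ?n)"
    using kron_mult[OF G G H(1) H(1)] H(2) by (simp only: kron_one)
  ultimately have "mass d h k * ((1 / jac h k) \<cdot>\<^sub>m kron H H) = 1\<^sub>m (n_soln d)"
    using mult_smult_distrib[OF smult_carrier_mat[OF kron_carrier[OF G G], of "jac h k"]
        kron_carrier[OF H(1) H(1)], of "1 / jac h k"]
      mult_smult_assoc_mat[OF kron_carrier[OF G G] kron_carrier[OF H(1) H(1)], of "jac h k"]
    by (auto simp: n_soln_def intro!: eq_matI)
  moreover have "(1 / jac h k) \<cdot>\<^sub>m kron H H \<in> carrier_mat (n_soln d) (n_soln d)"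
    unfolding n_soln_def using kron_carrier[OF H(1) H(1)] by simp
  ultimately show ?thesis by (rule invertible_matI_right[OF mass_carrier, rotated])
qed

section \<open>Constants under the operators\<close>

lemma eval_mat_mult_ones:
  "eval_mat b m pts *\<^sub>v ones m = vec (length pts) (\<lambda>i. \<Sum>j<m. b j (pts ! i))"
  by (rule eq_vecI) (auto simp: eval_mat_def ones_def scalar_prod_def atLeast0LessThan)

lemma sum_tensor:
  fixes f g :: "nat \<Rightarrow> real"
  shows "(\<Sum>j<n * n. f (j mod n) * g (j div n)) = (\<Sum>j<n. f j) * (\<Sum>j<n. g j)"
  by (subst sum_mod_div[of "\<lambda>a b. f a * g b"]) (simp add: sum_product)

lemma nodes_partition_of_unity:
  assumes "n \<ge> 2"
  shows "(\<Sum>i<n. lagrange (nodes r n) i) = 1"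
  using lagrange_partition_of_unity[OF distinct_nodes, of r n] length_nodes[OF assms, of r] assms
  by fastforce

text \<open>The product of two one-dimensional partitions of unity is one in the plane.\<close>
lemma chi_ones:
  assumes "deg d \<ge> 1"
  shows "chi d pts *\<^sub>v ones (n_soln d) = ones (length pts)"
proof -
  let ?l = "lagrange (nodes (soln_rule d) (deg d + 1))"
  have "(\<Sum>j<deg d + 1. poly (?l j) x) = 1" for x
    using arg_cong[OF nodes_partition_of_unity[of "deg d + 1" "soln_rule d"], of "\<lambda>q. poly q x"] assms
    by (simp add: poly_sum)
  then have "(\<Sum>j<n_soln d. basis (soln_rule d) (deg d + 1) j z) = 1" for z
    using sum_tensor[of "\<lambda>j. poly (?l j) (fst z)" "deg d + 1" "\<lambda>j. poly (?l j) (snd z)"]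
    by (simp only: n_soln_def basis_def case_prod_unfold mult_1)
  then show ?thesis unfolding chi_def eval_mat_mult_ones by (simp add: ones_def)
qed

lemma D_xi_ones:
  assumes "deg d \<ge> 1"
  shows "D_xi d *\<^sub>v ones (n_soln d) = 0\<^sub>v (n_soln d)"
proof -
  let ?l = "lagrange (nodes (soln_rule d) (deg d + 1))"
  have "(\<Sum>j<n. pderiv (?l j)) = pderiv (\<Sum>j<n. ?l j)" for n
    by (induction n) (auto simp: pderiv_add)
  moreover have "pderiv (\<Sum>j<deg d + 1. ?l j) = 0" using assms by (subst nodes_partition_of_unity) auto
  ultimately have "(\<Sum>j<deg d + 1. pderiv (?l j)) = 0" by simp
  then have "(\<Sum>j<deg d + 1. poly (pderiv (?l j)) x) = 0" for x
    by (metis poly_0 poly_sum)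
  then have "(\<Sum>j<n_soln d. basis_dxi (soln_rule d) (deg d + 1) j z) = 0" for z
    using sum_tensor[of "\<lambda>j. poly (pderiv (?l j)) (fst z)" "deg d + 1" "\<lambda>j. poly (?l j) (snd z)"]
    by (simp only: n_soln_def basis_dxi_def case_prod_unfold mult_zero_left)
  then show ?thesis unfolding D_xi_def eval_mat_mult_ones by (auto simp: n_soln_def)
qed

lemma mult_mat_zero_vec:
  fixes A :: "'a :: semiring_0 mat"
  assumes "A \<in> carrier_mat a b"
  shows "A *\<^sub>v 0\<^sub>v b = 0\<^sub>v a"
  using assms by (intro eq_vecI) auto

text \<open>Rightmost in the flux reconstruction matrix stands the \<open>p\<close>-th power of the derivative, and \<open>p \<ge> 1\<close>.\<close>
lemma fr_mat_ones:
  assumes "deg d \<ge> 1"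
  shows "fr_mat d h k *\<^sub>v ones (n_soln d) = 0\<^sub>v (n_soln d)"
proof -
  let ?N = "n_soln d"
  obtain q where q: "deg d = Suc q" using assms by (cases "deg d") auto
  have e: "ones ?N \<in> carrier_vec ?N" by (simp add: ones_def)
  have P: "D_xi d ^\<^sub>m k \<in> carrier_mat ?N ?N" for k by (rule pow_carrier_mat[OF D_xi_carrier])
  have "(D_xi d ^\<^sub>m deg d) *\<^sub>v ones ?N = (D_xi d ^\<^sub>m q) *\<^sub>v (D_xi d *\<^sub>v ones ?N)"
    using assoc_mult_mat_vec[OF P D_xi_carrier e] by (simp add: q)
  also have "\<dots> = 0\<^sub>v ?N" by (simp add: D_xi_ones[OF assms] mult_mat_zero_vec[OF P])
  finally have De: "(D_xi d ^\<^sub>m deg d) *\<^sub>v ones ?N = 0\<^sub>v ?N" .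
  let ?A = "transpose_mat (D_xi d ^\<^sub>m deg d) * mass d h k"
  have A: "?A \<in> carrier_mat ?N ?N" using P[of "deg d"] mass_carrier[of d h k] by auto
  have cA: "c \<cdot>\<^sub>m ?A \<in> carrier_mat ?N ?N" for c using A by simp
  have "fr_mat d h k *\<^sub>v ones ?N =
      (fr_param d / jac1 h k \<cdot>\<^sub>m ?A) *\<^sub>v ((D_xi d ^\<^sub>m deg d) *\<^sub>v ones ?N)"
    unfolding fr_mat_def mult_smult_assoc_mat[OF A P, symmetric]
    by (rule assoc_mult_mat_vec[OF cA P e])
  also have "\<dots> = 0\<^sub>v ?N" by (simp only: De mult_mat_zero_vec[OF cA])
  finally show ?thesis .
qed

lemma transpose_congruence:
  fixes A S :: "real mat"
  assumes A: "A \<in> carrier_mat a b" and S: "S \<in> carrier_mat a a" "transpose_mat S = S"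
  shows "transpose_mat (transpose_mat A * S * A) = transpose_mat A * S * A"
proof -
  have At: "transpose_mat A \<in> carrier_mat b a" using A by simp
  show ?thesis
    using transpose_mult[OF mult_carrier_mat[OF At S(1)] A] transpose_mult[OF At S(1)]
      assoc_mult_mat[OF At S(1) A] S(2) by simp
qed

lemma transpose_diag_of [simp]: "transpose_mat (diag_of w) = diag_of w"
  by (rule eq_matI) (auto simp: diag_of_def mat_diag_def)

lemma transpose_smult: "transpose_mat (c \<cdot>\<^sub>m A) = c \<cdot>\<^sub>m transpose_mat A"
  by (rule eq_matI) auto

lemma mass_symmetric: "transpose_mat (mass d h k) = mass d h k"
  unfolding mass_def using W_q_carrier[of d] chi_carrier[of d "vol_pts d"]
  by (intro transpose_congruence) (auto simp: transpose_smult W_q_def)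

lemma fr_mat_symmetric: "transpose_mat (fr_mat d h k) = fr_mat d h k"
  unfolding fr_mat_def transpose_smult
  by (subst transpose_congruence[OF pow_carrier_mat[OF D_xi_carrier] mass_carrier mass_symmetric]) simp

text \<open>By symmetry \<open>\<one> M = (M \<one>\<^sup>T)\<^sup>T\<close> and \<open>M \<one>\<^sup>T = (M + K) \<one>\<^sup>T\<close>, since \<open>K\<close> annihilates constants. This is
  where conservation becomes independent of the value of the flux reconstruction parameter.\<close>
lemma ones_mass_inverse:
  assumes p: "deg d \<ge> 1" and inv: "invertible_mat (mass d h k + fr_mat d h k)"
    and z: "z \<in> carrier_vec (n_soln d)"
  shows "ones (n_soln d) \<bullet> (mass d h k *\<^sub>v (mat_inv (mass d h k + fr_mat d h k) *\<^sub>v z)) = ones (n_soln d) \<bullet> z"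
proof -
  let ?N = "n_soln d" and ?M = "mass d h k" and ?K = "fr_mat d h k"
  let ?y = "mat_inv (?M + ?K) *\<^sub>v z"
  have e: "ones ?N \<in> carrier_vec ?N" by (simp add: ones_def)
  have MK: "?M + ?K \<in> carrier_mat ?N ?N" using mass_carrier fr_mat_carrier by auto
  note I = mat_inv_right[OF MK inv]
  have y: "?y \<in> carrier_vec ?N" using I z by auto
  have "transpose_mat (?M + ?K) = ?M + ?K"
    by (subst transpose_add[OF mass_carrier fr_mat_carrier]) (simp add: mass_symmetric fr_mat_symmetric)
  moreover have "(?M + ?K) *\<^sub>v ones ?N = ?M *\<^sub>v ones ?N"
    using add_mult_distrib_mat_vec[OF mass_carrier fr_mat_carrier e, of h k h k] mass_carrier[of d h k] e
    by (simp add: fr_mat_ones[OF p])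
  ultimately have "ones ?N \<bullet> (?M *\<^sub>v ?y) = ones ?N \<bullet> ((?M + ?K) *\<^sub>v ?y)"
    using transpose_vec_mult_scalar[OF MK y e] transpose_vec_mult_scalar[OF mass_carrier y e, of h k]
    by (simp add: mass_symmetric)
  also have "(?M + ?K) *\<^sub>v ?y = z"
    using assoc_mult_mat_vec[OF MK I(1) z] I(2) z by simp
  finally show ?thesis .
qed

section \<open>Volume and surface terms\<close>

lemma skew_hadamard_sum_zero:
  fixes Q F :: "real mat"
  assumes "Q \<in> carrier_mat n n" "F \<in> carrier_mat n n"
    and skew: "\<And>i j. i < n \<Longrightarrow> j < n \<Longrightarrow> Q $$ (j, i) = - Q $$ (i, j)"
    and sym: "\<And>i j. i < n \<Longrightarrow> j < n \<Longrightarrow> F $$ (j, i) = F $$ (i, j)"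
  shows "ones n \<bullet> ((Q \<odot> F) *\<^sub>v ones n) = 0"
proof -
  let ?S = "\<Sum>i<n. \<Sum>j<n. Q $$ (i, j) * F $$ (i, j)"
  have "ones n \<bullet> ((Q \<odot> F) *\<^sub>v ones n) = ?S"
    using assms(1,2) by (simp add: scalar_prod_def ones_def hadamard_def atLeast0LessThan)
  moreover have "?S = - ?S"
  proof -
    have "?S = (\<Sum>j<n. \<Sum>i<n. Q $$ (i, j) * F $$ (i, j))" by (rule sum.swap)
    also have "\<dots> = (\<Sum>j<n. \<Sum>i<n. - (Q $$ (j, i) * F $$ (j, i)))"
    proof (intro sum.cong refl)
      fix j i assume "j \<in> {..<n}" "i \<in> {..<n}"
      then show "Q $$ (i, j) * F $$ (i, j) = - (Q $$ (j, i) * F $$ (j, i))"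
        using skew[of j i] sym[of j i] by simp
    qed
    finally show ?thesis by (simp add: sum_negf)
  qed
  ultimately show ?thesis by simp
qed

lemma length_face_pts:
  assumes "deg d \<ge> 1"
  shows "length (face_pts d) = 4 * n_face d"
  using length_nodes[of "n_face d" "flux_rule d"] assms
  by (simp add: face_pts_def face_nodes_def n_face_def)

lemma W_f_diag:
  "W_f d = mat_diag (4 * n_face d)
     (\<lambda>i. (let w = weights (flux_rule d) (n_face d) in w @ w @ w @ w) ! i)"
proof -
  have "n_face d + (n_face d + (n_face d + n_face d)) = 4 * n_face d" by simp
  then show ?thesis by (simp only: W_f_def diag_of_def Let_def length_append length_weights)
qed

lemma W_f_carrier: "W_f d \<in> carrier_mat (4 * n_face d) (4 * n_face d)"
  by (simp only: W_f_diag mat_diag_dim)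

lemma skew_stiffness_carrier:
  assumes "dim_col D = n_quad d"
  shows "skew_stiffness d D nrm \<in> carrier_mat (n_all d) (n_all d)"
  using assms W_q_carrier[of d] by (auto simp: skew_stiffness_def n_all_def)

text \<open>The volume block is skew as a matrix minus its transpose, and the two off-diagonal blocks are
  negative transposes of each other because all weights and normals are diagonal. The entries are
  computed blockwise.\<close>
lemma skew_stiffness_skew:
  assumes D: "D \<in> carrier_mat (n_quad d) (n_quad d)" and nrm: "length nrm = 4 * n_face d"
    and p: "deg d \<ge> 1" and i: "i < n_all d" and j: "j < n_all d"
  shows "skew_stiffness d D nrm $$ (j, i) = - skew_stiffness d D nrm $$ (i, j)"
proof -
  let ?q = "n_quad d" and ?f = "4 * n_face d"
  define w where "w = (\<lambda>i. tensor_weights (flux_rule d) (n_face d) ! i)"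
  define v where "v = (\<lambda>i. (let w = weights (flux_rule d) (n_face d) in w @ w @ w @ w) ! i)"
  let ?P = "phi d (face_pts d)"
  have P: "?P \<in> carrier_mat ?f ?q"
    using length_face_pts[OF p] by (simp add: phi_def eval_mat_def)
  then have Pt: "transpose_mat ?P \<in> carrier_mat ?q ?f" by simp
  have Dt: "transpose_mat D \<in> carrier_mat ?q ?q" using D by simp
  have Wq: "W_q d = mat_diag ?q w"
    by (simp add: W_q_def diag_of_def w_def tensor_weights_def n_quad_def)
  have Wf: "W_f d = mat_diag ?f v"
    by (simp only: W_f_diag v_def)
  have N: "diag_of nrm = mat_diag ?f (\<lambda>i. nrm ! i)"
    by (simp add: diag_of_def nrm)
  have blocks: "skew_stiffness d D nrm = four_block_mat
      (mat ?q ?q (\<lambda>(i, j). w i * D $$ (i, j) - D $$ (j, i) * w j))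
      (mat ?q ?f (\<lambda>(i, j). ?P $$ (j, i) * v j * nrm ! j))
      (mat ?f ?q (\<lambda>(i, j). - (v i * nrm ! i * ?P $$ (i, j))))
      (0\<^sub>m ?f ?f)"
  proof -
    have "W_q d * D - transpose_mat D * W_q d
        = mat ?q ?q (\<lambda>(i, j). w i * D $$ (i, j) - D $$ (j, i) * w j)"
      unfolding Wq mat_diag_mult_left[OF D] mat_diag_mult_right[OF Dt] using D by (intro eq_matI) auto
    moreover have "transpose_mat ?P * W_f d * diag_of nrm
        = mat ?q ?f (\<lambda>(i, j). ?P $$ (j, i) * v j * nrm ! j)"
      unfolding Wf N mat_diag_mult_right[OF Pt]
      using P by (subst mat_diag_mult_right[of _ "?q"]) (auto intro!: eq_matI)
    moreover have "W_f d * diag_of nrm = mat_diag ?f (\<lambda>i. v i * nrm ! i)"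
      unfolding Wf N by (rule mat_diag_diag)
    then have "- (W_f d * diag_of nrm * ?P) = mat ?f ?q (\<lambda>(i, j). - (v i * nrm ! i * ?P $$ (i, j)))"
      unfolding mat_diag_mult_left[OF P] by (auto simp: mat_diag_mult_left[OF P] intro!: eq_matI)
    ultimately show ?thesis by (simp only: skew_stiffness_def)
  qed
  show ?thesis
    unfolding blocks using i j by (auto simp: n_all_def)
qed

lemma sum_lessThan_add:
  fixes h :: "nat \<Rightarrow> 'a :: comm_monoid_add"
  shows "(\<Sum>i<a + b. h i) = (\<Sum>i<a. h i) + (\<Sum>i<b. h (a + i))"
  by (induction b) (auto simp: add.assoc)

lemma sum_four_blocks:
  fixes h :: "nat \<Rightarrow> real"
  shows "(\<Sum>i<4 * n. h i) = (\<Sum>j<n. h j) + (\<Sum>j<n. h (n + j)) + (\<Sum>j<n. h (2 * n + j)) + (\<Sum>j<n. h (3 * n + j))"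
proof -
  have "4 * n = ((n + n) + n) + n" "2 * n = n + n" "3 * n = (n + n) + n" by simp_all
  then show ?thesis by (simp only: sum_lessThan_add)
qed

definition face_sum :: "disc \<Rightarrow> nat \<Rightarrow> real vec \<Rightarrow> real" where
  "face_sum d i f = ones (n_face d) \<bullet> (W_face d *\<^sub>v on_face d i f)"

lemma mat_diag_mult_vec:
  assumes "v \<in> carrier_vec n"
  shows "mat_diag n f *\<^sub>v v = vec n (\<lambda>i. f i * v $ i)"
  using assms
  by (intro eq_vecI)
     (auto simp: mat_diag_def scalar_prod_def if_distrib[of "\<lambda>x. x * _"] cong: if_cong)

lemma face_sum_eq:
  "face_sum d i f = (\<Sum>j<n_face d. weights (flux_rule d) (n_face d) ! j * f $ ((i - 1) * n_face d + j))"
proof -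
  have "on_face d i f \<in> carrier_vec (n_face d)" by (simp add: on_face_def)
  then show ?thesis
    by (simp add: face_sum_def W_face_def diag_of_def mat_diag_mult_vec)
       (simp add: ones_def scalar_prod_def on_face_def atLeast0LessThan)
qed

text \<open>The test function 1 has value 1 at all face nodes, so only the weights and the normal of each
  face remain.\<close>
lemma boundary_sum:
  assumes p: "deg d \<ge> 1" and f: "f \<in> carrier_vec (4 * n_face d)"
    and nrm: "nrm = replicate (n_face d) n1 @ replicate (n_face d) n2 @
      replicate (n_face d) n3 @ replicate (n_face d) n4"
  shows "ones (n_soln d) \<bullet> ((transpose_mat (chi d (face_pts d)) * W_f d * diag_of nrm) *\<^sub>v f)
    = n1 * face_sum d 1 f + n2 * face_sum d 2 f + n3 * face_sum d 3 f + n4 * face_sum d 4 f"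
proof -
  let ?N = "n_soln d" and ?f = "4 * n_face d" and ?n = "n_face d"
  define w where "w = weights (flux_rule d) (n_face d)"
  define v where "v = (\<lambda>i. (w @ w @ w @ w) ! i)"
  have lw: "length w = ?n" by (simp add: w_def)
  let ?C = "chi d (face_pts d)"
  have C: "?C \<in> carrier_mat ?f ?N" using chi_carrier[of d "face_pts d"] length_face_pts[OF p] by simp
  then have Ct: "transpose_mat ?C \<in> carrier_mat ?N ?f" by simp
  have e: "ones ?N \<in> carrier_vec ?N" by (simp add: ones_def)
  have Wf: "W_f d = mat_diag ?f v"
    by (simp only: W_f_diag v_def w_def Let_def)
  have ln: "length nrm = ?f" by (simp add: nrm)
  have N: "diag_of nrm = mat_diag ?f (\<lambda>i. nrm ! i)"
    by (simp only: diag_of_def ln)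
  have B: "mat_diag ?f (\<lambda>i. v i * nrm ! i) \<in> carrier_mat ?f ?f" by simp
  have "transpose_mat ?C * W_f d * diag_of nrm = transpose_mat ?C * mat_diag ?f (\<lambda>i. v i * nrm ! i)"
    unfolding Wf N using assoc_mult_mat[OF Ct, of "mat_diag ?f v" ?f "mat_diag ?f ((!) nrm)" ?f]
    by (simp add: mat_diag_diag)
  then have "ones ?N \<bullet> ((transpose_mat ?C * W_f d * diag_of nrm) *\<^sub>v f)
      = ones ?N \<bullet> (transpose_mat ?C *\<^sub>v (mat_diag ?f (\<lambda>i. v i * nrm ! i) *\<^sub>v f))"
    using assoc_mult_mat_vec[OF Ct B f] by simp
  also have "\<dots> = (?C *\<^sub>v ones ?N) \<bullet> (mat_diag ?f (\<lambda>i. v i * nrm ! i) *\<^sub>v f)"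
    using transpose_vec_mult_scalar[OF Ct mult_mat_vec_carrier[OF B f] e] by simp
  also have "\<dots> = (\<Sum>i<?f. v i * nrm ! i * f $ i)"
    unfolding chi_ones[OF p] length_face_pts[OF p] mat_diag_mult_vec[OF f]
    by (simp add: scalar_prod_def ones_def atLeast0LessThan)
  also have "\<dots> = (\<Sum>j<?n. w ! j * n1 * f $ j) + (\<Sum>j<?n. w ! j * n2 * f $ (?n + j))
      + (\<Sum>j<?n. w ! j * n3 * f $ (2 * ?n + j)) + (\<Sum>j<?n. w ! j * n4 * f $ (3 * ?n + j))"
    unfolding sum_four_blocks
    by (intro arg_cong2[of _ _ _ _ "(+)"] sum.cong refl) (auto simp: v_def nrm nth_append lw)
  also have "\<dots> = n1 * face_sum d 1 f + n2 * face_sum d 2 f + n3 * face_sum d 3 f + n4 * face_sum d 4 f"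
    by (simp add: face_sum_eq w_def sum_distrib_left mult.assoc mult.left_commute)
  finally show ?thesis .
qed

lemma mat_inv_carrier_fr:
  assumes "invertible_mat (mass d h k + fr_mat d h k)"
  shows "mat_inv (mass d h k + fr_mat d h k) \<in> carrier_mat (n_soln d) (n_soln d)"
  using mat_inv_right(1)[OF add_carrier_mat[OF fr_mat_carrier], OF assms] .

lemma ones_append: "ones a @\<^sub>v ones b = ones (a + b)"
  by (rule eq_vecI) (auto simp: ones_def)

text \<open>Testing with 1 on the solution space becomes summation over all volume and face nodes, where
  skew-symmetry of the stiffness operator and symmetry of the flux matrix cancel the contributions
  of \<open>(i, j)\<close> and \<open>(j, i)\<close>.\<close>
lemma volume_term_vanishes:
  assumes p: "deg d \<ge> 1" and D: "D \<in> carrier_mat (n_quad d) (n_quad d)"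
    and nrm: "length nrm = 4 * n_face d"
    and F: "F \<in> carrier_mat (n_all d) (n_all d)"
      "\<And>i j. i < n_all d \<Longrightarrow> j < n_all d \<Longrightarrow> F $$ (j, i) = F $$ (i, j)"
  shows "ones (n_soln d) \<bullet> (transpose_mat (chi_all d) *\<^sub>v
      ((skew_stiffness d D nrm \<odot> F) *\<^sub>v ones (n_all d))) = 0"
proof -
  let ?N = "n_soln d"
  let ?Q = "skew_stiffness d D nrm"
  have Q: "?Q \<in> carrier_mat (n_all d) (n_all d)" using D by (intro skew_stiffness_carrier) auto
  have V: "chi d (vol_pts d) \<in> carrier_mat (n_quad d) ?N" using chi_carrier[of d "vol_pts d"] by simp
  have C: "chi d (face_pts d) \<in> carrier_mat (4 * n_face d) ?N"
    using chi_carrier[of d "face_pts d"] length_face_pts[OF p] by simp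
  have A: "chi_all d \<in> carrier_mat (n_all d) ?N"
    unfolding chi_all_def n_all_def by (rule carrier_append_rows[OF V C])
  then have At: "transpose_mat (chi_all d) \<in> carrier_mat ?N (n_all d)" by simp
  have e: "ones ?N \<in> carrier_vec ?N" by (simp add: ones_def)
  have z: "(?Q \<odot> F) *\<^sub>v ones (n_all d) \<in> carrier_vec (n_all d)"
    using Q by (auto simp: hadamard_def intro!: carrier_vecI)
  have "chi_all d *\<^sub>v ones ?N = ones (n_quad d) @\<^sub>v ones (4 * n_face d)"
    by (simp only: chi_all_def mat_mult_append[OF V C e] chi_ones[OF p] length_face_pts[OF p] length_vol_pts)
  then have "chi_all d *\<^sub>v ones ?N = ones (n_all d)"
    by (simp only: ones_append n_all_def)
  then have "ones ?N \<bullet> (transpose_mat (chi_all d) *\<^sub>v ((?Q \<odot> F) *\<^sub>v ones (n_all d)))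
      = ones (n_all d) \<bullet> ((?Q \<odot> F) *\<^sub>v ones (n_all d))"
    using transpose_vec_mult_scalar[OF At z e] by (simp only: transpose_transpose)
  also have "\<dots> = 0"
    by (rule skew_hadamard_sum_zero[OF Q F(1) skew_stiffness_skew[OF D nrm p] F(2)])
  finally show ?thesis .
qed

text \<open>The two-point fluxes are symmetric on admissible states only; the entropy-projected states are
  admissible because the entropy variables are injective there.\<close>
lemma flux_mat_symmetric:
  assumes ent: "has_convex_entropy L" and F: "two_point_flux (states L) g F"
    and adm: "admissible L d h k u" and "i < n_all d" "j < n_all d"
  shows "flux_mat F L d h k u a $$ (j, i) = flux_mat F L d h k u a $$ (i, j)"
proof -
  have "utilde L d h k u i \<in> states L" if "i < n_all d" for i
    unfolding utilde_def state_of_def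
    using ent adm that by (intro the_inv_into_into) (auto simp: has_convex_entropy_def admissible_def)
  then show ?thesis using F assms(4,5) by (simp add: flux_mat_def two_point_flux_def)
qed

section \<open>Conservation\<close>

text \<open>The residual paired with the functional \<open>\<one> M\<close>, term by term.\<close>
lemma element_balance:
  assumes ent: "has_convex_entropy L"
    and Fs: "two_point_flux (states L) gs (flux2_s L)"
    and Ft: "two_point_flux (states L) gt (flux2_t L)"
    and p: "deg d \<ge> 1" and h: "0 < h" "0 < k"
    and inv: "invertible_mat (mass d h k + fr_mat d h k)"
    and adm: "admissible L d h k u"
    and ft: "ft \<in> carrier_vec (4 * n_face d)" and fs: "fs \<in> carrier_vec (4 * n_face d)"
    and res: "residual L d h k u a ft fs = 0\<^sub>v (n_soln d)"
  shows "face_sum d 4 ft - face_sum d 3 ft + (face_sum d 2 fs - face_sum d 1 fs) = 0"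
proof -
  let ?N = "n_soln d" and ?M = "mass d h k" and ?MK = "mass d h k + fr_mat d h k"
  let ?A = "transpose_mat (chi_all d)"
  let ?vt = "(Q_t d \<odot> flux_mat (flux2_t L) L d h k u a) *\<^sub>v ones (n_all d)"
  let ?vs = "(Q_s d \<odot> flux_mat (flux2_s L) L d h k u a) *\<^sub>v ones (n_all d)"
  let ?Bt = "transpose_mat (chi d (face_pts d)) * W_f d * diag_of (normal_t d)"
  let ?Bs = "transpose_mat (chi d (face_pts d)) * W_f d * diag_of (normal_s d)"
  have e: "ones ?N \<in> carrier_vec ?N" by (simp add: ones_def)
  have M: "?M \<in> carrier_mat ?N ?N" by (rule mass_carrier)
  note MI = mat_inv_right[OF M mass_invertible[OF p h inv]]
  note MKI = mat_inv_carrier_fr[OF inv]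
  have len: "length (normal_t d) = 4 * n_face d" "length (normal_s d) = 4 * n_face d"
    by (auto simp: normal_t_def normal_s_def)
  have D: "dtau_phi d (vol_pts d) \<in> carrier_mat (n_quad d) (n_quad d)"
    "dxi_phi d (vol_pts d) \<in> carrier_mat (n_quad d) (n_quad d)"
    by (simp_all add: dtau_phi_def dxi_phi_def eval_mat_def)
  have Q: "Q_t d \<in> carrier_mat (n_all d) (n_all d)" "Q_s d \<in> carrier_mat (n_all d) (n_all d)"
    unfolding Q_t_def Q_s_def using D by (auto intro!: skew_stiffness_carrier)
  have v: "?vt \<in> carrier_vec (n_all d)" "?vs \<in> carrier_vec (n_all d)"
    using Q by (auto simp: hadamard_def intro!: carrier_vecI)
  have C: "chi d (face_pts d) \<in> carrier_mat (4 * n_face d) ?N"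
    using chi_carrier[of d "face_pts d"] length_face_pts[OF p] by simp
  then have Ct: "transpose_mat (chi d (face_pts d)) \<in> carrier_mat ?N (4 * n_face d)" by simp
  have "chi d (vol_pts d) \<in> carrier_mat (n_quad d) ?N" using chi_carrier[of d "vol_pts d"] by simp
  from carrier_append_rows[OF this C] have A: "?A \<in> carrier_mat ?N (n_all d)"
    by (simp add: chi_all_def n_all_def)
  have B: "?Bt \<in> carrier_mat ?N (4 * n_face d)" "?Bs \<in> carrier_mat ?N (4 * n_face d)"
    by (simp_all only: diag_of_def len)
       (rule mult_carrier_mat[OF mult_carrier_mat[OF Ct W_f_carrier] mat_diag_dim])+
  have fm: "flux_mat F L d h k u a \<in> carrier_mat (n_all d) (n_all d)" for F
    by (simp add: flux_mat_def)
  have z: "?A *\<^sub>v ?vt \<in> carrier_vec ?N" "?Bt *\<^sub>v ft \<in> carrier_vec ?N"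
    "?A *\<^sub>v ?vs \<in> carrier_vec ?N" "?Bs *\<^sub>v fs \<in> carrier_vec ?N"
    by (rule mult_mat_vec_carrier[OF A v(1)] mult_mat_vec_carrier[OF B(1) ft]
        mult_mat_vec_carrier[OF A v(2)] mult_mat_vec_carrier[OF B(2) fs])+
  let ?x1 = "mat_inv ?M *\<^sub>v (?A *\<^sub>v ?vt)" and ?x2 = "mat_inv ?M *\<^sub>v (?Bt *\<^sub>v ft)"
  let ?x3 = "mat_inv ?MK *\<^sub>v (?A *\<^sub>v ?vs)" and ?x4 = "mat_inv ?MK *\<^sub>v (?Bs *\<^sub>v fs)"
  have x: "?x1 \<in> carrier_vec ?N" "?x2 \<in> carrier_vec ?N" "?x3 \<in> carrier_vec ?N" "?x4 \<in> carrier_vec ?N"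
    by (rule mult_mat_vec_carrier[OF MI(1) z(1)] mult_mat_vec_carrier[OF MI(1) z(2)]
        mult_mat_vec_carrier[OF MKI z(3)] mult_mat_vec_carrier[OF MKI z(4)])+
  have "residual L d h k u a ft fs = ?x1 + ?x2 + ?x3 + ?x4"
    unfolding residual_def lift_t_def lift_fr_s_def
      assoc_mult_mat_vec[OF MI(1) A v(1)] assoc_mult_mat_vec[OF MI(1) B(1) ft]
      assoc_mult_mat_vec[OF MKI A v(2)] assoc_mult_mat_vec[OF MKI B(2) fs] ..
  then have "?M *\<^sub>v (?x1 + ?x2 + ?x3 + ?x4) = 0\<^sub>v ?N"
    using res mult_mat_zero_vec[OF M] by simp
  then have "?M *\<^sub>v ?x1 + ?M *\<^sub>v ?x2 + ?M *\<^sub>v ?x3 + ?M *\<^sub>v ?x4 = 0\<^sub>v ?N"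
    by (simp only: mult_add_distrib_mat_vec[OF M] add_carrier_vec x)
  then have "ones ?N \<bullet> (?M *\<^sub>v ?x1 + ?M *\<^sub>v ?x2 + ?M *\<^sub>v ?x3 + ?M *\<^sub>v ?x4) = 0"
    by (simp only: scalar_prod_right_zero[OF e])
  then have sum0: "ones ?N \<bullet> (?M *\<^sub>v ?x1) + ones ?N \<bullet> (?M *\<^sub>v ?x2)
      + ones ?N \<bullet> (?M *\<^sub>v ?x3) + ones ?N \<bullet> (?M *\<^sub>v ?x4) = 0"
    by (simp only: scalar_prod_add_distrib[OF e] add_carrier_vec mult_mat_vec_carrier[OF M] x)
  have MMI: "?M *\<^sub>v (mat_inv ?M *\<^sub>v y) = y" if "y \<in> carrier_vec ?N" for y
    using assoc_mult_mat_vec[OF M MI(1) that] MI(2) that by simp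
  have t1: "ones ?N \<bullet> (?A *\<^sub>v ?vt) = 0"
    unfolding Q_t_def
    by (rule volume_term_vanishes[OF p D(1) len(1) fm flux_mat_symmetric[OF ent Ft adm]])
  have t3: "ones ?N \<bullet> (?A *\<^sub>v ?vs) = 0"
    unfolding Q_s_def
    by (rule volume_term_vanishes[OF p D(2) len(2) fm flux_mat_symmetric[OF ent Fs adm]])
  have t2: "ones ?N \<bullet> (?Bt *\<^sub>v ft) = face_sum d 4 ft - face_sum d 3 ft"
    using boundary_sum[OF p ft normal_t_def] by simp
  have t4: "ones ?N \<bullet> (?Bs *\<^sub>v fs) = face_sum d 2 fs - face_sum d 1 fs"
    using boundary_sum[OF p fs normal_s_def] by simp
  show ?thesis
    using sum0 t1 t2 t3 t4
    by (simp only: MMI[OF z(1)] MMI[OF z(2)] ones_mass_inverse[OF p inv z(3)] ones_mass_inverse[OF p inv z(4)])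
qed

lemma periodic_shift_sum:
  fixes h :: "nat \<Rightarrow> 'a :: comm_monoid_add"
  shows "(\<Sum>k<n. h ((k + 1) mod n)) = (\<Sum>k<n. h k)"
proof (cases n)
  case (Suc m)
  have "(\<Sum>k<Suc m. h ((k + 1) mod Suc m)) = (\<Sum>k<m. h ((k + 1) mod Suc m)) + h 0"
    by simp
  also have "(\<Sum>k<m. h ((k + 1) mod Suc m)) = (\<Sum>k<m. h (Suc k))"
    by (intro sum.cong) auto
  also have "\<dots> + h 0 = (\<Sum>k<Suc m. h k)"
    by (simp only: sum.lessThan_Suc_shift add.commute)
  finally show ?thesis using Suc by simp
qed simp

text \<open>Summed over a timeslab, the spatial face terms cancel between neighbours, and the interfaces
  between timeslabs pass the temporal flux on unchanged.\<close>
theorem theorem2: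
  fixes L :: "('s::finite) law" and d :: disc and m :: mesh
    and xL xR T :: real and u0 :: "real \<Rightarrow> real ^ 's"
    and u ft fs :: "'s field"
  assumes "has_convex_entropy L"
    and "two_point_flux (states L) (flux_s L) (flux2_s L)"
    and "two_point_flux (states L) (\<lambda>w. w) (flux2_t L)"
    and "deg d \<ge> 1"
    and "cartesian_mesh m xL xR T"
    and "\<forall>k < nx m. \<forall>l < nt m.
           invertible_mat (mass d (dx m k) (dt m l) + fr_mat d (dx m k) (dt m l))"
    and "interface_single_valued d m ft" and "interface_single_valued d m fs"
    and "initial_data d m u0 ft"
    and "outflow L d m u ft"
    and "st_nsfr_solution L d m u ft fs"
  shows "\<forall>a. (\<Sum>k<nx m. scalar_prod (ones (n_face d)) (W_face d *\<^sub>v on_face d 3 (ft k 0 a)))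
           = (\<Sum>k<nx m. scalar_prod (ones (n_face d)) (W_face d *\<^sub>v on_face d 4 (ft k (nt m - 1) a)))"
proof
  fix a
  let ?ft = "\<lambda>i k l. face_sum d i (ft k l a)" and ?fs = "\<lambda>i k l. face_sum d i (fs k l a)"
  note mesh = assms(5)[unfolded cartesian_mesh_def]
  have balance: "?ft 4 k l - ?ft 3 k l + (?fs 2 k l - ?fs 1 k l) = 0" if "k < nx m" "l < nt m" for k l
  proof (rule element_balance[OF assms(1-4)])
    show "0 < dx m k" "0 < dt m l" using mesh that by (auto simp: dx_def dt_def)
    show "invertible_mat (mass d (dx m k) (dt m l) + fr_mat d (dx m k) (dt m l))"
      using assms(6) that by blast
  qed (use assms(11) that in \<open>auto simp: st_nsfr_solution_def\<close>)
  have space: "?fs 2 k l = ?fs 1 ((k + 1) mod nx m) l" if "k < nx m" "l < nt m" for k l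
    using assms(8) that by (simp add: interface_single_valued_def face_sum_def)
  have time: "?ft 4 k l = ?ft 3 k (l + 1)" if "k < nx m" "l + 1 < nt m" for k l
    using assms(7) that by (simp add: interface_single_valued_def face_sum_def)
  have slab: "(\<Sum>k<nx m. ?ft 4 k l) = (\<Sum>k<nx m. ?ft 3 k l)" if l: "l < nt m" for l
  proof -
    have "(\<Sum>k<nx m. ?fs 2 k l) = (\<Sum>k<nx m. ?fs 1 ((k + 1) mod nx m) l)"
      using l by (intro sum.cong) (auto simp: space)
    also have "\<dots> = (\<Sum>k<nx m. ?fs 1 k l)" by (rule periodic_shift_sum)
    finally have "(\<Sum>k<nx m. ?fs 2 k l) = (\<Sum>k<nx m. ?fs 1 k l)" .
    moreover have "(\<Sum>k<nx m. ?ft 4 k l - ?ft 3 k l + (?fs 2 k l - ?fs 1 k l)) = 0"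
      using balance l by (intro sum.neutral) auto
    ultimately show ?thesis by (simp add: sum.distrib sum_subtractf)
  qed
  have "(\<Sum>k<nx m. ?ft 4 k l) = (\<Sum>k<nx m. ?ft 3 k 0)" if "l < nt m" for l
    using that
  proof (induction l)
    case 0
    then show ?case by (rule slab)
  next
    case (Suc l)
    have "(\<Sum>k<nx m. ?ft 4 k (Suc l)) = (\<Sum>k<nx m. ?ft 3 k (Suc l))" by (rule slab[OF Suc.prems])
    also have "\<dots> = (\<Sum>k<nx m. ?ft 4 k l)" using Suc.prems by (intro sum.cong) (auto simp: time)
    finally show ?case using Suc by simp
  qed
  from this[of "nt m - 1"]
  show "(\<Sum>k<nx m. ones (n_face d) \<bullet> (W_face d *\<^sub>v on_face d 3 (ft k 0 a)))
      = (\<Sum>k<nx m. ones (n_face d) \<bullet> (W_face d *\<^sub>v on_face d 4 (ft k (nt m - 1) a)))"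
    using mesh by (simp add: face_sum_def)
qed

end
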